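(* Let $d\ge3$, let $\mathcal{W}\subseteq L^\infty(\mathbb{T}^d)$ be a finite dimensional subspace and let $R>0$. Let $\mathcal{W}_R=\{q\in\mathcal{W}:\|q\|_{L^\infty(\mathbb{T}^d)}\le R\}$, equipped with the $L^2$ norm. Let $q\in\mathcal{W}_R$ be such that $0$ is not a Dirichlet eigenvalue of $-\Delta+q$ in $\mathbb{T}^d$ (regarded as a domain in $\mathbb{R}^d$), and let $N\in\mathbb{N}$ be such that $$\|P_N^\perp F P_{\mathcal{W}}\|_{L^2(\mathbb{T}^d)\to\ell^2}\le\tfrac14 .$$ Set $y=P_NU(q)$ and define $A\colon\mathcal{W}_R\to\mathcal{W}_R$ by $$A(\tilde q)=P_{\mathcal{W}_R}\left(F^{-1}y+F^{-1}P_N^\perp F\tilde q-F^{-1}P_NB(\tilde q)\right).$$ Let $q_0\in\mathcal{W}_R$ be arbitrary and define the sequence $q_n=A(q_{n-1})$ for $n\ge1$. Then $$\|q-q_n\|_{L^2(\mathbb{T}^d)}\le4\left(\tfrac34\right)^n\|q_1-q_0\|_{L^2(\mathbb{T}^d)},\qquad n\ge1.$$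
   Context: Notation: $\mathbb{T}=[0,1]$; functions on $\mathbb{T}^d$ are extended by zero to $\mathbb{R}^d$. Fix $p\in(d,+\infty)$ and $s>\frac{dp}{2(p-d)}$. The dot product on $\mathbb{C}^d$ is bilinear. $P_{\mathcal{W}}$ is the orthogonal projection of $L^2(\mathbb{T}^d)$ onto $\mathcal{W}$, and $P_{\mathcal{W}_R}$ is the (nearest point) projection of $L^2(\mathbb{T}^d)$ onto the closed convex set $\mathcal{W}_R$. Fix a bijection $\rho\colon\mathbb{N}\to\mathbb{Z}^d$, $l\mapsto k_l$ (with $\mathbb N=\{1,2,\dots\}$). $P_N\colon\ell^\infty\to\ell^\infty$ is the projection $P_N(a_1,a_2,\dots)=(a_1,\dots,a_N,0,0,\dots)$, and $P_N^\perp=I-P_N$. Complex geometrical optics (CGO) solutions: for each $k\in\mathbb{Z}^d$ choose $\xi,\eta\in\mathbb{R}^d$ with $|\xi|=|\eta|=1$ and $\xi\cdot\eta=\xi\cdot k=\eta\cdot k=0$, and for $t\in\mathbb{R}$ set $$\zeta_1^{k,t}=-i(\pi k+t\xi)+\sqrt{t^2+\pi^2|k|^2}\,\eta,\qquad \zeta_2^{k,t}=-i(\pi k-t\xi)-\sqrt{t^2+\pi^2|k|^2}\,\eta,$$ so that $\zeta_j^{k,t}\cdot\zeta_j^{k,t}=0$ and $\zeta_1^{k,t}+\zeta_2^{k,t}=-2\pi ik$. There is a constant $c>0$ depending only on $d,p,R$ such that for every potential $q\in L^\infty(\mathbb{T}^d)$ with $\|q\|_{L^\infty(\mathbb{T}^d)}\le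 R$, every $k\in\mathbb{Z}^d$ and every $t\ge c$ there is a unique solution $\psi^{k,t}$ of $(-\Delta+q)\psi=0$ in $\mathbb{R}^d$ of the form $\psi^{k,t}(x)=e^{\zeta_1^{k,t}\cdot x}(1+r^{k,t}(x))$ with $r^{k,t}$ in the weighted space $\{r:(1+|x|^2)^{-1/4}r\in L^2(\mathbb{R}^d)\}$; $r^{k,t}=r^{k,t}(q)$ is called the remainder. Given $t_k\ge c$ for every $k\in\mathbb{Z}^d$, define for $\|q\|_{L^\infty(\mathbb{T}^d)}\le R$ the sequences $$(U(q))_l=\int_{\mathbb{T}^d}q(x)e^{\zeta_2^{k_l,t_{k_l}}\cdot x}\psi^{k_l,t_{k_l}}(x)\,dx,\qquad (B(q))_l=\int_{\mathbb{T}^d}q(x)e^{-2\pi ik_l\cdot x}\,r^{k_l,t_{k_l}}(x)\,dx,$$ and let $F\colon L^2(\mathbb{T}^d)\to\ell^2$ be the discrete Fourier transform $(Fq)_l=\int_{\mathbb{T}^d}q(x)e^{-2\pi ik_l\cdot x}\,dx$; thus $U=F+B$. Throughout, $t_k=c'(|k|^s+1)$ for $k\in\mathbb{Z}^d$, where $c'>0$ is a constant depending only on $d,s,p,R$ such that $t_k\ge c$ for all $k$ and $\|B(q_2)-B(q_1)\|_{\ell^2}\le\frac12\|q_2-q_1\|_{L^2(\mathbb{T}^d)}$ for all $q_1,q_2\in L^\infty(\mathbb{T}^d)$ with $\|q_i\|_{L^\infty(\mathbb{T}^d)}\le R$, $i=1,2$. *)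

theory Defs
  imports "HOL-Analysis.Analysis" "HOL-Probability.Essential_Supremum"
begin

section \<open>Function spaces on the unit cube\<close>

text \<open>
  The dimension $d$ is the cardinality of the index type \<open>'n\<close>. Elements of $L^2$ and $L^\infty$ of
  the cube are complex-valued functions that represent their almost-everywhere class with respect
  to Lebesgue measure on the cube; values outside the cube are irrelevant. In the differential
  equation on the whole space the function is extended by zero explicitly (\<open>zero_ext\<close>).
\<close>

definition cube :: "(real ^ 'n) set" where
  "cube = cbox 0 1"

abbreviation cube_measure :: "(real ^ 'n) measure" where
  "cube_measure \<equiv> lebesgue_on cube"

definition L2 :: "(real ^ 'n \<Rightarrow> complex) set" where
  "L2 = {f \<in> borel_measurable cube_measure. integrable cube_measure (\<lambda>x. (cmod (f x))\<^sup>2)}"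

definition L2_norm :: "(real ^ 'n \<Rightarrow> complex) \<Rightarrow> real" where
  "L2_norm f = sqrt (LINT x|cube_measure. (cmod (f x))\<^sup>2)"

definition L2_inner :: "(real ^ 'n \<Rightarrow> complex) \<Rightarrow> (real ^ 'n \<Rightarrow> complex) \<Rightarrow> complex" where
  "L2_inner f g = (LINT x|cube_measure. f x * cnj (g x))"

definition Linf_norm :: "(real ^ 'n \<Rightarrow> complex) \<Rightarrow> ereal" where
  "Linf_norm f = esssup cube_measure (\<lambda>x. ereal (cmod (f x)))"

definition Linf :: "(real ^ 'n \<Rightarrow> complex) set" where
  "Linf = {f \<in> borel_measurable cube_measure. Linf_norm f < \<infinity>}"

definition zero_ext :: "(real ^ 'n \<Rightarrow> complex) \<Rightarrow> real ^ 'n \<Rightarrow> complex" where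
  "zero_ext q x = (if x \<in> cube then q x else 0)"

text \<open>
  A set of representatives that is the full preimage of a finite-dimensional complex linear
  subspace of the quotient space $L^\infty$.
\<close>

definition finite_dim_subspace_Linf :: "(real ^ 'n \<Rightarrow> complex) set \<Rightarrow> bool" where
  "finite_dim_subspace_Linf W \<longleftrightarrow>
     W \<subseteq> Linf \<and>
     (\<lambda>x. 0) \<in> W \<and>
     (\<forall>f\<in>W. \<forall>g\<in>W. (\<lambda>x. f x + g x) \<in> W) \<and>
     (\<forall>a::complex. \<forall>f\<in>W. (\<lambda>x. a * f x) \<in> W) \<and>
     (\<forall>f\<in>W. \<forall>g\<in>Linf. (AE x in cube_measure. g x = f x) \<longrightarrow> g \<in> W) \<and>
     (\<exists>B. finite B \<and> B \<subseteq> W \<and>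
        (\<forall>f\<in>W. \<exists>a :: (real ^ 'n \<Rightarrow> complex) \<Rightarrow> complex.
           AE x in cube_measure. f x = (\<Sum>b\<in>B. a b * b x)))"

definition Linf_ball :: "(real ^ 'n \<Rightarrow> complex) set \<Rightarrow> real \<Rightarrow> (real ^ 'n \<Rightarrow> complex) set" where
  "Linf_ball W R = {q \<in> W. Linf_norm q \<le> ereal R}"

text \<open>
  Both projections are unique only up to almost-everywhere equality; the choice operator picks a
  representative.
\<close>

definition orth_proj :: "(real ^ 'n \<Rightarrow> complex) set \<Rightarrow> (real ^ 'n \<Rightarrow> complex) \<Rightarrow> real ^ 'n \<Rightarrow> complex" where
  "orth_proj W f = (SOME g. g \<in> W \<and> (\<forall>w\<in>W. L2_inner (\<lambda>x. f x - g x) w = 0))"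

definition nearest_point :: "(real ^ 'n \<Rightarrow> complex) set \<Rightarrow> (real ^ 'n \<Rightarrow> complex) \<Rightarrow> real ^ 'n \<Rightarrow> complex" where
  "nearest_point S f =
     (SOME g. g \<in> S \<and> (\<forall>h\<in>S. L2_norm (\<lambda>x. f x - g x) \<le> L2_norm (\<lambda>x. f x - h x)))"


section \<open>Sequences\<close>

text \<open>Sequences are indexed by $\{1,2,\dots\}$; the entry at index 0 is never used.\<close>

definition ell2_norm :: "(nat \<Rightarrow> complex) \<Rightarrow> ereal" where
  "ell2_norm a =
     (if (\<lambda>l. (cmod (a l))\<^sup>2) summable_on {1..}
      then ereal (sqrt (\<Sum>\<^sub>\<infinity>l\<in>{1..}. (cmod (a l))\<^sup>2)) else \<infinity>)"

definition seq_proj :: "nat \<Rightarrow> (nat \<Rightarrow> complex) \<Rightarrow> nat \<Rightarrow> complex" where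
  "seq_proj N a l = (if l \<in> {1..N} then a l else 0)"

definition seq_proj_compl :: "nat \<Rightarrow> (nat \<Rightarrow> complex) \<Rightarrow> nat \<Rightarrow> complex" where
  "seq_proj_compl N a l = a l - seq_proj N a l"

text \<open>The operator norm, as a supremum in the extended reals.\<close>

definition L2_ell2_opnorm :: "((real ^ 'n \<Rightarrow> complex) \<Rightarrow> nat \<Rightarrow> complex) \<Rightarrow> ereal" where
  "L2_ell2_opnorm T = (SUP f\<in>{f \<in> L2. L2_norm f \<le> 1}. ell2_norm (T f))"


section \<open>The discrete Fourier transform\<close>

definition real_vec :: "int ^ 'n \<Rightarrow> real ^ 'n" where
  "real_vec k = (\<chi> i. real_of_int (k $ i))"

definition fourier :: "(nat \<Rightarrow> int ^ 'n) \<Rightarrow> (real ^ 'n \<Rightarrow> complex) \<Rightarrow> nat \<Rightarrow> complex" where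
  "fourier \<rho> q l =
     (LINT x|cube_measure. q x * exp (- 2 * complex_of_real pi * \<i> * of_real (real_vec (\<rho> l) \<bullet> x)))"

definition fourier_inv :: "(nat \<Rightarrow> int ^ 'n) \<Rightarrow> (nat \<Rightarrow> complex) \<Rightarrow> real ^ 'n \<Rightarrow> complex" where
  "fourier_inv \<rho> a = (SOME f. f \<in> L2 \<and> (\<forall>l\<ge>1. fourier \<rho> f l = a l))"


section \<open>Test functions and the Schroedinger equation\<close>

definition partial :: "'n \<Rightarrow> (real ^ 'n \<Rightarrow> complex) \<Rightarrow> real ^ 'n \<Rightarrow> complex" where
  "partial i f x = frechet_derivative f (at x) (axis i 1)"

definition smooth :: "(real ^ 'n \<Rightarrow> complex) \<Rightarrow> bool" where
  "smooth f \<longleftrightarrow> (\<forall>is. fold partial is f differentiable_on UNIV)"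

definition test_function :: "(real ^ 'n) set \<Rightarrow> (real ^ 'n \<Rightarrow> complex) \<Rightarrow> bool" where
  "test_function S \<phi> \<longleftrightarrow>
     smooth \<phi> \<and> compact (closure {x. \<phi> x \<noteq> 0}) \<and> closure {x. \<phi> x \<noteq> 0} \<subseteq> S"

definition laplacian :: "(real ^ 'n \<Rightarrow> complex) \<Rightarrow> real ^ 'n \<Rightarrow> complex" where
  "laplacian f x = (\<Sum>i\<in>UNIV. partial i (partial i f) x)"

text \<open>
  $(-\Delta+q)\psi=0$ in the whole space, in the sense of distributions; \<open>\<psi>\<close> is understood to be
  locally square integrable and \<open>q\<close> bounded.
\<close>

definition schroedinger_solution :: "(real ^ 'n \<Rightarrow> complex) \<Rightarrow> (real ^ 'n \<Rightarrow> complex) \<Rightarrow> bool" where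
  "schroedinger_solution q \<psi> \<longleftrightarrow>
     (\<forall>\<phi>. test_function UNIV \<phi> \<longrightarrow>
        (LINT x|lebesgue. \<psi> x * (- laplacian \<phi> x + q x * \<phi> x)) = 0)"

text \<open>
  Membership of \<open>u\<close> in $H^1_0$ of the open cube (the $H^1$-closure of the test functions), with
  weak gradient \<open>G\<close>.
\<close>

definition H10_with_gradient :: "(real ^ 'n \<Rightarrow> complex) \<Rightarrow> (real ^ 'n \<Rightarrow> complex ^ 'n) \<Rightarrow> bool" where
  "H10_with_gradient u G \<longleftrightarrow>
     u \<in> L2 \<and> (\<forall>i. (\<lambda>x. G x $ i) \<in> L2) \<and>
     (\<exists>\<phi> :: nat \<Rightarrow> real ^ 'n \<Rightarrow> complex.
        (\<forall>m. test_function (interior cube) (\<phi> m)) \<and>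
        (\<lambda>m. L2_norm (\<lambda>x. \<phi> m x - u x)) \<longlonglongrightarrow> 0 \<and>
        (\<forall>i. (\<lambda>m. L2_norm (\<lambda>x. partial i (\<phi> m) x - G x $ i)) \<longlonglongrightarrow> 0))"

definition dirichlet_eigenvalue :: "(real ^ 'n \<Rightarrow> complex) \<Rightarrow> complex \<Rightarrow> bool" where
  "dirichlet_eigenvalue q \<mu> \<longleftrightarrow>
     (\<exists>u G. H10_with_gradient u G \<and> \<not> (AE x in cube_measure. u x = 0) \<and>
        (\<forall>\<phi>. test_function (interior cube) \<phi> \<longrightarrow>
           (LINT x|cube_measure. (\<Sum>i\<in>UNIV. G x $ i * partial i \<phi> x) + q x * u x * \<phi> x)
             = \<mu> * (LINT x|cube_measure. u x * \<phi> x)))"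


section \<open>Complex geometrical optics solutions\<close>

definition complex_vec :: "real ^ 'n \<Rightarrow> complex ^ 'n" where
  "complex_vec x = (\<chi> i. complex_of_real (x $ i))"

text \<open>The bilinear (not Hermitian) dot product.\<close>

definition cdot :: "complex ^ 'n \<Rightarrow> complex ^ 'n \<Rightarrow> complex" where
  "cdot z w = (\<Sum>i\<in>UNIV. z $ i * w $ i)"

definition cgo_directions :: "(int ^ 'n \<Rightarrow> real ^ 'n) \<Rightarrow> (int ^ 'n \<Rightarrow> real ^ 'n) \<Rightarrow> bool" where
  "cgo_directions \<xi> \<eta> \<longleftrightarrow>
     (\<forall>k. norm (\<xi> k) = 1 \<and> norm (\<eta> k) = 1 \<and>
        \<xi> k \<bullet> \<eta> k = 0 \<and> \<xi> k \<bullet> real_vec k = 0 \<and> \<eta> k \<bullet> real_vec k = 0)"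

definition zeta1 :: "(int ^ 'n \<Rightarrow> real ^ 'n) \<Rightarrow> (int ^ 'n \<Rightarrow> real ^ 'n) \<Rightarrow> int ^ 'n \<Rightarrow> real \<Rightarrow> complex ^ 'n" where
  "zeta1 \<xi> \<eta> k t =
     (- \<i>) *s complex_vec (pi *\<^sub>R real_vec k + t *\<^sub>R \<xi> k)
     + complex_vec (sqrt (t\<^sup>2 + pi\<^sup>2 * (norm (real_vec k))\<^sup>2) *\<^sub>R \<eta> k)"

definition zeta2 :: "(int ^ 'n \<Rightarrow> real ^ 'n) \<Rightarrow> (int ^ 'n \<Rightarrow> real ^ 'n) \<Rightarrow> int ^ 'n \<Rightarrow> real \<Rightarrow> complex ^ 'n" where
  "zeta2 \<xi> \<eta> k t =
     (- \<i>) *s complex_vec (pi *\<^sub>R real_vec k - t *\<^sub>R \<xi> k)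
     - complex_vec (sqrt (t\<^sup>2 + pi\<^sup>2 * (norm (real_vec k))\<^sup>2) *\<^sub>R \<eta> k)"

definition cgo_form :: "(int ^ 'n \<Rightarrow> real ^ 'n) \<Rightarrow> (int ^ 'n \<Rightarrow> real ^ 'n) \<Rightarrow> int ^ 'n \<Rightarrow> real
    \<Rightarrow> (real ^ 'n \<Rightarrow> complex) \<Rightarrow> real ^ 'n \<Rightarrow> complex" where
  "cgo_form \<xi> \<eta> k t r x = exp (cdot (zeta1 \<xi> \<eta> k t) (complex_vec x)) * (1 + r x)"

definition weighted_L2 :: "(real ^ 'n \<Rightarrow> complex) set" where
  "weighted_L2 = {r \<in> borel_measurable lebesgue.
     integrable lebesgue (\<lambda>x. (cmod (of_real ((1 + (norm x)\<^sup>2) powr (- 1 / 4)) * r x))\<^sup>2)}"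

definition is_cgo_remainder :: "(int ^ 'n \<Rightarrow> real ^ 'n) \<Rightarrow> (int ^ 'n \<Rightarrow> real ^ 'n)
    \<Rightarrow> (real ^ 'n \<Rightarrow> complex) \<Rightarrow> int ^ 'n \<Rightarrow> real \<Rightarrow> (real ^ 'n \<Rightarrow> complex) \<Rightarrow> bool" where
  "is_cgo_remainder \<xi> \<eta> q k t r \<longleftrightarrow>
     r \<in> weighted_L2 \<and> schroedinger_solution (zero_ext q) (cgo_form \<xi> \<eta> k t r)"

definition cgo_remainder :: "(int ^ 'n \<Rightarrow> real ^ 'n) \<Rightarrow> (int ^ 'n \<Rightarrow> real ^ 'n)
    \<Rightarrow> (real ^ 'n \<Rightarrow> complex) \<Rightarrow> int ^ 'n \<Rightarrow> real \<Rightarrow> real ^ 'n \<Rightarrow> complex" where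
  "cgo_remainder \<xi> \<eta> q k t = (SOME r. is_cgo_remainder \<xi> \<eta> q k t r)"

definition cgo_solution :: "(int ^ 'n \<Rightarrow> real ^ 'n) \<Rightarrow> (int ^ 'n \<Rightarrow> real ^ 'n)
    \<Rightarrow> (real ^ 'n \<Rightarrow> complex) \<Rightarrow> int ^ 'n \<Rightarrow> real \<Rightarrow> real ^ 'n \<Rightarrow> complex" where
  "cgo_solution \<xi> \<eta> q k t = cgo_form \<xi> \<eta> k t (cgo_remainder \<xi> \<eta> q k t)"

text \<open>
  The property of the threshold constant \<open>c\<close>: unique solvability (up to null sets) for all
  potentials bounded by \<open>R\<close> and all parameters $t\ge c$.
\<close>

definition cgo_threshold :: "(int ^ 'n \<Rightarrow> real ^ 'n) \<Rightarrow> (int ^ 'n \<Rightarrow> real ^ 'n) \<Rightarrow> real \<Rightarrow> real \<Rightarrow> bool" where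
  "cgo_threshold \<xi> \<eta> R c \<longleftrightarrow>
     c > 0 \<and>
     (\<forall>q\<in>Linf_ball Linf R. \<forall>k. \<forall>t\<ge>c.
        \<exists>r. is_cgo_remainder \<xi> \<eta> q k t r \<and>
          (\<forall>r'. is_cgo_remainder \<xi> \<eta> q k t r' \<longrightarrow> (AE x in lebesgue. r' x = r x)))"

text \<open>In the following, \<open>\<tau> k\<close> is the parameter $t_k$.\<close>

definition U_map :: "(nat \<Rightarrow> int ^ 'n) \<Rightarrow> (int ^ 'n \<Rightarrow> real ^ 'n) \<Rightarrow> (int ^ 'n \<Rightarrow> real ^ 'n)
    \<Rightarrow> (int ^ 'n \<Rightarrow> real) \<Rightarrow> (real ^ 'n \<Rightarrow> complex) \<Rightarrow> nat \<Rightarrow> complex" where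
  "U_map \<rho> \<xi> \<eta> \<tau> q l =
     (LINT x|cube_measure. q x * exp (cdot (zeta2 \<xi> \<eta> (\<rho> l) (\<tau> (\<rho> l))) (complex_vec x))
        * cgo_solution \<xi> \<eta> q (\<rho> l) (\<tau> (\<rho> l)) x)"

definition B_map :: "(nat \<Rightarrow> int ^ 'n) \<Rightarrow> (int ^ 'n \<Rightarrow> real ^ 'n) \<Rightarrow> (int ^ 'n \<Rightarrow> real ^ 'n)
    \<Rightarrow> (int ^ 'n \<Rightarrow> real) \<Rightarrow> (real ^ 'n \<Rightarrow> complex) \<Rightarrow> nat \<Rightarrow> complex" where
  "B_map \<rho> \<xi> \<eta> \<tau> q l =
     (LINT x|cube_measure. q x * exp (- 2 * complex_of_real pi * \<i> * of_real (real_vec (\<rho> l) \<bullet> x))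
        * cgo_remainder \<xi> \<eta> q (\<rho> l) (\<tau> (\<rho> l)) x)"

definition cgo_parameter :: "real \<Rightarrow> real \<Rightarrow> int ^ 'n \<Rightarrow> real" where
  "cgo_parameter c' s k = c' * (norm (real_vec k) powr s + 1)"

text \<open>
  The properties of the constant \<open>c'\<close>. As \<open>ell2_norm\<close> is infinite on sequences that are not square
  summable, the inequality includes that the difference lies in $\ell^2$.
\<close>

definition cgo_scale :: "(nat \<Rightarrow> int ^ 'n) \<Rightarrow> (int ^ 'n \<Rightarrow> real ^ 'n) \<Rightarrow> (int ^ 'n \<Rightarrow> real ^ 'n)
    \<Rightarrow> real \<Rightarrow> real \<Rightarrow> real \<Rightarrow> real \<Rightarrow> bool" where
  "cgo_scale \<rho> \<xi> \<eta> s R c c' \<longleftrightarrow>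
     c' > 0 \<and>
     (\<forall>k :: int ^ 'n. cgo_parameter c' s k \<ge> c) \<and>
     (\<forall>q1\<in>Linf_ball Linf R. \<forall>q2\<in>Linf_ball Linf R.
        ell2_norm (\<lambda>l. B_map \<rho> \<xi> \<eta> (cgo_parameter c' s) q2 l - B_map \<rho> \<xi> \<eta> (cgo_parameter c' s) q1 l)
          \<le> ereal (1 / 2 * L2_norm (\<lambda>x. q2 x - q1 x)))"

text \<open>One step of the reconstruction algorithm with data \<open>y\<close> on the set \<open>S\<close>.\<close>

definition iteration_map :: "(nat \<Rightarrow> int ^ 'n) \<Rightarrow> (int ^ 'n \<Rightarrow> real ^ 'n) \<Rightarrow> (int ^ 'n \<Rightarrow> real ^ 'n)
    \<Rightarrow> (int ^ 'n \<Rightarrow> real) \<Rightarrow> (real ^ 'n \<Rightarrow> complex) set \<Rightarrow> nat \<Rightarrow> (nat \<Rightarrow> complex)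
    \<Rightarrow> (real ^ 'n \<Rightarrow> complex) \<Rightarrow> real ^ 'n \<Rightarrow> complex" where
  "iteration_map \<rho> \<xi> \<eta> \<tau> S N y q =
     nearest_point S
       (\<lambda>x. fourier_inv \<rho> y x
          + fourier_inv \<rho> (seq_proj_compl N (fourier \<rho> q)) x
          - fourier_inv \<rho> (seq_proj N (B_map \<rho> \<xi> \<eta> \<tau> q)) x)"

end

theory Submission
  imports Defs
begin

text \<open>
  Let $f$ be an iterate and let $g$ be the function whose nearest point is the next iterate. The
  point of the proof is that the Fourier coefficients of $q-g$ can be read off. As $U=F+B$, the
  coefficient at $l\le N$ is $B(f)_l-B(q)_l$, and at $l>N$ it is $F(q-f)_l$. The Lipschitz estimate
  for $B$ bounds the square sum of the first group by $\frac14\|q-f\|^2$, and the smallness of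
  $P_N^\perp F P_W$ bounds the second by $\frac1{16}\|q-f\|^2$, because $q-f$ lies in $W$. Hence
  $\|q-g\|\le\frac34\|q-f\|$ (\<open>update_distance\<close>). Since $q$ belongs to the convex set onto which
  one projects, replacing $g$ by its nearest point moves it no farther from $q$
  (\<open>nearest_point_closer\<close>). So each step shrinks the distance to $q$ by the factor $\frac34$; the
  triangle inequality $\|q-q_0\|\le\|q-q_1\|+\|q_1-q_0\|$ then gives $\|q-q_0\|\le4\|q_1-q_0\|$.

  Three ingredients carry this. The norm of a function is controlled by its Fourier coefficients
  (\<open>Parseval_bound\<close>), which is the completeness of the trigonometric system. It follows from the
  Stone--Weierstrass theorem on the torus in $\mathbb{C}^d$ and the inner regularity of Lebesgue
  measure. Second, the nearest point exists: a minimising sequence is Cauchy by the parallelogram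
  law, its coordinates in an orthonormal basis of $W$ converge, and the bound by $R$ survives
  pointwise limits (\<open>nearest_point_Linf_ball\<close>). Third, $U=F+B$ holds because the two complex
  exponentials multiply to a character and the remainder is square integrable on the cube
  (\<open>U_map_eq\<close>).

  All the sequences to which $F^{-1}$ is applied are finitely supported or differ from the transform
  of a square integrable function by a finitely supported one, so that a preimage can be written down
  with a trigonometric polynomial.
\<close>

section \<open>The geometry of $L^2$ of the cube\<close>

lemma finite_cube_measure: "finite_measure (cube_measure :: (real ^ 'n) measure)"
  by (rule finite_measure_lebesgue_on) (simp add: cube_def)

lemma L2_measurable: "f \<in> L2 \<Longrightarrow> f \<in> borel_measurable cube_measure"
  by (simp add: L2_def)

lemma L2_square_integrable: "f \<in> L2 \<Longrightarrow> integrable cube_measure (\<lambda>x. (cmod (f x))\<^sup>2)"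
  by (simp add: L2_def)

text \<open>
  The main source of membership proofs: boundedness, multiples, products with bounded functions and
  restrictions of weighted spaces are all instances.
\<close>

lemma L2_dominated:
  assumes f: "f \<in> borel_measurable cube_measure" and g: "g \<in> L2"
    and le: "AE x in cube_measure. cmod (f x) \<le> C * cmod (g x)"
  shows "f \<in> L2"
proof -
  note [measurable] = f L2_measurable[OF g]
  have "integrable cube_measure (\<lambda>x. (cmod (f x))\<^sup>2)"
  proof (rule Bochner_Integration.integrable_bound)
    show "integrable cube_measure (\<lambda>x. C\<^sup>2 * (cmod (g x))\<^sup>2)"
      using L2_square_integrable[OF g] by simp
    show "AE x in cube_measure. norm ((cmod (f x))\<^sup>2) \<le> norm (C\<^sup>2 * (cmod (g x))\<^sup>2)"
      using le
    proof eventually_elim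
      case (elim x)
      then have "(cmod (f x))\<^sup>2 \<le> (C * cmod (g x))\<^sup>2"
        by (intro power_mono) auto
      then show ?case by (simp add: power_mult_distrib)
    qed
  qed measurable
  then show ?thesis using f by (simp add: L2_def)
qed

lemma L2_bounded:
  assumes f: "f \<in> borel_measurable cube_measure" and le: "AE x in cube_measure. cmod (f x) \<le> C"
  shows "f \<in> L2"
proof (rule L2_dominated[OF f])
  interpret finite_measure cube_measure by (rule finite_cube_measure)
  show "(\<lambda>x. 1) \<in> L2" by (simp add: L2_def)
  show "AE x in cube_measure. cmod (f x) \<le> C * cmod 1" using le by simp
qed

lemma L2_scale: "f \<in> L2 \<Longrightarrow> (\<lambda>x. a * f x) \<in> L2"
  by (rule L2_dominated[where g = f and C = "cmod a"])
    (auto simp: norm_mult dest!: L2_measurable)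

lemma L2_add:
  assumes f: "f \<in> L2" and g: "g \<in> L2"
  shows "(\<lambda>x. f x + g x) \<in> L2"
proof -
  note [measurable] = L2_measurable[OF f] L2_measurable[OF g]
  have "integrable cube_measure (\<lambda>x. (cmod (f x + g x))\<^sup>2)"
  proof (rule Bochner_Integration.integrable_bound)
    show "integrable cube_measure (\<lambda>x. 2 * (cmod (f x))\<^sup>2 + 2 * (cmod (g x))\<^sup>2)"
      using L2_square_integrable[OF f] L2_square_integrable[OF g] by simp
    have "(cmod (z + w))\<^sup>2 \<le> 2 * (cmod z)\<^sup>2 + 2 * (cmod w)\<^sup>2" for z w
    proof -
      have "(cmod (z + w))\<^sup>2 \<le> (cmod z + cmod w)\<^sup>2"
        by (intro power_mono norm_triangle_ineq) simp
      also have "\<dots> \<le> 2 * (cmod z)\<^sup>2 + 2 * (cmod w)\<^sup>2"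
        using sum_squares_bound[of "cmod z" "cmod w"] by (simp add: power2_sum)
      finally show ?thesis .
    qed
    then show "AE x in cube_measure. norm ((cmod (f x + g x))\<^sup>2)
        \<le> norm (2 * (cmod (f x))\<^sup>2 + 2 * (cmod (g x))\<^sup>2)"
      by (intro AE_I2) simp
  qed measurable
  then show ?thesis by (simp add: L2_def)
qed

lemma L2_zero: "(\<lambda>x. 0) \<in> L2"
  by (simp add: L2_def)

lemma L2_diff: "f \<in> L2 \<Longrightarrow> g \<in> L2 \<Longrightarrow> (\<lambda>x. f x - g x) \<in> L2"
  using L2_add[of f "\<lambda>x. - 1 * g x"] L2_scale[of g "- 1"] by simp

lemma L2_sum: "(\<And>i. i \<in> I \<Longrightarrow> f i \<in> L2) \<Longrightarrow> (\<lambda>x. \<Sum>i\<in>I. f i x) \<in> L2"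
  by (induction I rule: infinite_finite_induct) (auto intro: L2_zero L2_add)

lemma L2_inner_integrable:
  assumes f: "f \<in> L2" and g: "g \<in> L2"
  shows "integrable cube_measure (\<lambda>x. f x * cnj (g x))"
proof (rule Bochner_Integration.integrable_bound)
  note [measurable] = L2_measurable[OF f] L2_measurable[OF g]
  show "integrable cube_measure (\<lambda>x. (cmod (f x))\<^sup>2 + (cmod (g x))\<^sup>2)"
    using L2_square_integrable[OF f] L2_square_integrable[OF g] by simp
  have "a * b \<le> a\<^sup>2 + b\<^sup>2" if "a \<ge> 0" "b \<ge> 0" for a b :: real
  proof -
    have "a * b \<ge> 0" using that by simp
    then show ?thesis using sum_squares_bound[of a b] by linarith
  qed
  then show "AE x in cube_measure. norm (f x * cnj (g x)) \<le> norm ((cmod (f x))\<^sup>2 + (cmod (g x))\<^sup>2)"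
    by (intro AE_I2) (simp add: norm_mult)
  show "(\<lambda>x. f x * cnj (g x)) \<in> borel_measurable cube_measure"
    using L2_measurable[OF f] L2_measurable[OF g]
    by (intro borel_measurable_times borel_measurable_continuous_on[where f = cnj] continuous_intros)
qed

lemma L2_inner_add_left:
  "f \<in> L2 \<Longrightarrow> g \<in> L2 \<Longrightarrow> h \<in> L2 \<Longrightarrow> L2_inner (\<lambda>x. f x + g x) h = L2_inner f h + L2_inner g h"
  by (simp add: L2_inner_def distrib_right L2_inner_integrable)

lemma L2_inner_scale_left: "L2_inner (\<lambda>x. a * f x) h = a * L2_inner f h"
  by (simp add: L2_inner_def mult.assoc)

lemma L2_inner_diff_left:
  "f \<in> L2 \<Longrightarrow> g \<in> L2 \<Longrightarrow> h \<in> L2 \<Longrightarrow> L2_inner (\<lambda>x. f x - g x) h = L2_inner f h - L2_inner g h"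
  by (simp add: L2_inner_def left_diff_distrib L2_inner_integrable)

lemma L2_inner_sum_left:
  "(\<And>i. i \<in> I \<Longrightarrow> f i \<in> L2) \<Longrightarrow> h \<in> L2 \<Longrightarrow>
    L2_inner (\<lambda>x. \<Sum>i\<in>I. f i x) h = (\<Sum>i\<in>I. L2_inner (f i) h)"
  by (simp add: L2_inner_def sum_distrib_right L2_inner_integrable)

lemma L2_inner_cnj: "cnj (L2_inner f g) = L2_inner g f"
  by (simp add: L2_inner_def mult.commute flip: Bochner_Integration.integral_cnj)

lemma L2_inner_add_right:
  "f \<in> L2 \<Longrightarrow> g \<in> L2 \<Longrightarrow> h \<in> L2 \<Longrightarrow> L2_inner h (\<lambda>x. f x + g x) = L2_inner h f + L2_inner h g"
  by (subst (1 2 3) L2_inner_cnj[symmetric]) (simp add: L2_inner_add_left)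

lemma L2_inner_diff_right:
  "f \<in> L2 \<Longrightarrow> g \<in> L2 \<Longrightarrow> h \<in> L2 \<Longrightarrow> L2_inner h (\<lambda>x. f x - g x) = L2_inner h f - L2_inner h g"
  by (subst (1 2 3) L2_inner_cnj[symmetric]) (simp add: L2_inner_diff_left)

lemma L2_inner_scale_right: "L2_inner h (\<lambda>x. a * f x) = cnj a * L2_inner h f"
  by (subst (1 2) L2_inner_cnj[symmetric]) (simp add: L2_inner_scale_left)

lemma L2_inner_sum_right:
  "(\<And>i. i \<in> I \<Longrightarrow> f i \<in> L2) \<Longrightarrow> h \<in> L2 \<Longrightarrow>
    L2_inner h (\<lambda>x. \<Sum>i\<in>I. f i x) = (\<Sum>i\<in>I. L2_inner h (f i))"
  by (subst (1 2) L2_inner_cnj[symmetric]) (simp add: L2_inner_sum_left)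

lemma L2_norm_nonneg [simp]: "0 \<le> L2_norm f"
  by (simp add: L2_norm_def)

lemma L2_norm_square: "(L2_norm f)\<^sup>2 = (LINT x|cube_measure. (cmod (f x))\<^sup>2)"
  by (simp add: L2_norm_def)

lemma L2_inner_self: "L2_inner f f = complex_of_real ((L2_norm f)\<^sup>2)"
  unfolding L2_norm_square L2_inner_def complex_norm_square[symmetric]
  by (simp flip: of_real_power)

lemma L2_inner_cong_AE:
  assumes "f \<in> borel_measurable cube_measure" "g \<in> borel_measurable cube_measure"
    and "h \<in> borel_measurable cube_measure"
    and "AE x in cube_measure. f x = g x"
  shows "L2_inner f h = L2_inner g h"
  unfolding L2_inner_def
proof (rule integral_cong_AE)
  show "AE x in cube_measure. f x * cnj (h x) = g x * cnj (h x)"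
    using assms(4) by eventually_elim simp
qed (use assms in \<open>auto intro!: borel_measurable_times borel_measurable_continuous_on[where f = cnj] continuous_intros\<close>)

lemma L2_norm_cong_AE:
  assumes "f \<in> borel_measurable cube_measure" "g \<in> borel_measurable cube_measure"
    and "AE x in cube_measure. f x = g x"
  shows "L2_norm f = L2_norm g"
  unfolding L2_norm_def
proof (intro arg_cong[where f = sqrt] integral_cong_AE)
  show "AE x in cube_measure. (cmod (f x))\<^sup>2 = (cmod (g x))\<^sup>2"
    using assms(3) by eventually_elim simp
qed (use assms in measurable)

lemma L2_norm_eq_0_iff:
  assumes "f \<in> L2"
  shows "L2_norm f = 0 \<longleftrightarrow> (AE x in cube_measure. f x = 0)"
  using integral_nonneg_eq_0_iff_AE[OF L2_square_integrable[OF assms]]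
  by (simp add: L2_norm_def)

lemma L2_norm_scale: "L2_norm (\<lambda>x. a * f x) = cmod a * L2_norm f"
  by (simp add: L2_norm_def norm_mult power_mult_distrib real_sqrt_mult)

lemma L2_norm_minus_commute: "L2_norm (\<lambda>x. f x - g x) = L2_norm (\<lambda>x. g x - f x)"
  by (simp add: L2_norm_def norm_minus_commute)

lemma L2_norm_add_square:
  assumes "f \<in> L2" "g \<in> L2"
  shows "(L2_norm (\<lambda>x. f x + g x))\<^sup>2 = (L2_norm f)\<^sup>2 + (L2_norm g)\<^sup>2 + 2 * Re (L2_inner f g)"
proof -
  have "complex_of_real ((L2_norm (\<lambda>x. f x + g x))\<^sup>2)
      = L2_inner f f + L2_inner g g + (L2_inner f g + cnj (L2_inner f g))"
    unfolding L2_inner_self[symmetric] L2_inner_cnj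
    using assms by (simp add: L2_inner_add_left L2_inner_add_right L2_add)
  also have "\<dots> = complex_of_real ((L2_norm f)\<^sup>2 + (L2_norm g)\<^sup>2 + 2 * Re (L2_inner f g))"
    unfolding L2_inner_self by (simp add: complex_add_cnj)
  finally show ?thesis by (simp only: of_real_eq_iff)
qed

lemma L2_norm_diff_square:
  assumes "f \<in> L2" "g \<in> L2"
  shows "(L2_norm (\<lambda>x. f x - g x))\<^sup>2 = (L2_norm f)\<^sup>2 + (L2_norm g)\<^sup>2 - 2 * Re (L2_inner f g)"
  using L2_norm_add_square[OF assms(1) L2_scale[OF assms(2), of "- 1"]]
    L2_norm_scale[of "- 1" g] L2_inner_scale_right[of f "- 1" g]
  by simp

text \<open>
  Expand the square norm of $f-cg$ with $cg$ the projection of $f$ onto the line through $g$.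
\<close>

lemma L2_Cauchy_Schwarz:
  assumes f: "f \<in> L2" and g: "g \<in> L2"
  shows "cmod (L2_inner f g) \<le> L2_norm f * L2_norm g"
proof (cases "L2_norm g = 0")
  case True
  then have "AE x in cube_measure. g x = 0" using g by (simp add: L2_norm_eq_0_iff)
  then have "L2_inner g f = L2_inner (\<lambda>x. 0) f"
    using f g by (intro L2_inner_cong_AE) (auto simp: L2_measurable)
  then have "L2_inner g f = 0" by (simp add: L2_inner_def)
  then show ?thesis using True L2_inner_cnj[of g f] by simp
next
  case False
  define c where "c = L2_inner f g / complex_of_real ((L2_norm g)\<^sup>2)"
  have "cnj c * L2_inner f g = complex_of_real ((cmod (L2_inner f g))\<^sup>2 / (L2_norm g)\<^sup>2)"
    using False complex_norm_square[of "L2_inner f g"] by (simp add: c_def mult.commute)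
  then have "Re (cnj c * L2_inner f g) = (cmod (L2_inner f g))\<^sup>2 / (L2_norm g)\<^sup>2"
    by (metis Re_complex_of_real)
  moreover have "(L2_norm (\<lambda>x. c * g x))\<^sup>2 = (cmod (L2_inner f g))\<^sup>2 / (L2_norm g)\<^sup>2"
    unfolding L2_norm_scale using False
    by (simp add: c_def norm_divide norm_mult power2_eq_square)
  ultimately have "(L2_norm (\<lambda>x. f x - c * g x))\<^sup>2
      = (L2_norm f)\<^sup>2 - (cmod (L2_inner f g))\<^sup>2 / (L2_norm g)\<^sup>2"
    by (simp only: L2_norm_diff_square[OF f L2_scale[OF g]] L2_inner_scale_right)
  then have "(cmod (L2_inner f g))\<^sup>2 / (L2_norm g)\<^sup>2 \<le> (L2_norm f)\<^sup>2"
    by (metis diff_ge_0_iff_ge zero_le_power2)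
  then have "(cmod (L2_inner f g))\<^sup>2 \<le> (L2_norm f * L2_norm g)\<^sup>2"
    using False by (simp add: divide_le_eq power_mult_distrib)
  then show ?thesis by (rule power2_le_imp_le) simp
qed

lemma L2_norm_triangle:
  assumes "f \<in> L2" "g \<in> L2"
  shows "L2_norm (\<lambda>x. f x + g x) \<le> L2_norm f + L2_norm g"
proof (rule power2_le_imp_le)
  have "Re (L2_inner f g) \<le> L2_norm f * L2_norm g"
    using complex_Re_le_cmod L2_Cauchy_Schwarz[OF assms] by (rule order_trans)
  then show "(L2_norm (\<lambda>x. f x + g x))\<^sup>2 \<le> (L2_norm f + L2_norm g)\<^sup>2"
    using L2_norm_add_square[OF assms] by (simp add: power2_sum)
qed simp

lemma L2_norm_triangle_diff:
  assumes "f \<in> L2" "g \<in> L2" "h \<in> L2"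
  shows "L2_norm (\<lambda>x. f x - h x) \<le> L2_norm (\<lambda>x. f x - g x) + L2_norm (\<lambda>x. g x - h x)"
  using L2_norm_triangle[OF L2_diff[OF assms(1,2)] L2_diff[OF assms(2,3)]] by simp

lemma L2_norm_sum_le:
  assumes "\<And>i. i \<in> I \<Longrightarrow> f i \<in> L2"
  shows "L2_norm (\<lambda>x. \<Sum>i\<in>I. f i x) \<le> (\<Sum>i\<in>I. L2_norm (f i))"
  using assms
proof (induction I rule: infinite_finite_induct)
  case (insert i I)
  then show ?case
    using L2_norm_triangle[of "f i" "\<lambda>x. \<Sum>i\<in>I. f i x"] by (auto simp: L2_sum)
qed (auto simp: L2_norm_def)

section \<open>The trigonometric system\<close>

definition trig :: "int ^ 'n \<Rightarrow> real ^ 'n \<Rightarrow> complex" where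
  "trig k x = exp (2 * complex_of_real pi * \<i> * of_real (real_vec k \<bullet> x))"

lemma cmod_trig [simp]: "cmod (trig k x) = 1"
  using norm_exp_i_times[of "2 * pi * (real_vec k \<bullet> x)"] by (simp add: trig_def mult_ac)

lemma trig_zero [simp]: "trig 0 x = 1"
  by (simp add: trig_def real_vec_def inner_vec_def)

lemma trig_add: "trig (k + l) x = trig k x * trig l x"
proof -
  have "real_vec (k + l) = real_vec k + real_vec l"
    by (simp add: real_vec_def vec_eq_iff)
  then show ?thesis by (simp add: trig_def inner_add_left ring_distribs exp_add)
qed

lemma cnj_trig: "cnj (trig k x) = trig (- k) x"
proof -
  have "real_vec (- k) = - real_vec k"
    by (simp add: real_vec_def vec_eq_iff)
  then show ?thesis by (simp add: trig_def exp_cnj)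
qed

lemma continuous_on_trig [continuous_intros]: "continuous_on S (trig k)"
  unfolding trig_def by (intro continuous_intros)

lemma continuous_on_cube_measurable:
  "continuous_on cube f \<Longrightarrow> f \<in> borel_measurable cube_measure"
  by (rule continuous_imp_measurable_on_sets_lebesgue) (simp_all add: cube_def)

lemma trig_L2: "trig k \<in> L2"
  by (rule L2_bounded[where C = 1])
    (auto intro!: continuous_on_cube_measurable continuous_on_trig)

lemma fourier_eq_inner: "fourier \<rho> f l = L2_inner f (trig (\<rho> l))"
  by (simp add: fourier_def L2_inner_def trig_def exp_cnj)

text \<open>
  The orthogonality relation in one variable, from the primitive of the exponential.
\<close>

lemma integral_unit_exp:
  "(LINT t|lborel. indicator {0..1::real} t *\<^sub>R exp (2 * complex_of_real pi * \<i> * of_real (real_of_int m * t)))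
     = (if m = 0 then 1 else 0)"
proof (cases "m = 0")
  case True
  then show ?thesis by (simp add: scaleR_conv_of_real)
next
  case False
  define c where "c = 2 * complex_of_real pi * \<i> * of_int m"
  have c: "c \<noteq> 0" using False by (simp add: c_def)
  have "(LINT t|lborel. indicator {0..1::real} t *\<^sub>R exp (c * of_real t)) = exp (c * of_real 1) / c - exp (c * of_real 0) / c"
  proof (rule integral_FTC_Icc)
    show "((\<lambda>t. exp (c * of_real t) / c) has_vector_derivative exp (c * of_real x)) (at x within {0..1})" for x
      using c by (auto intro!: derivative_eq_intros has_vector_derivative_real_field)
  qed (auto intro!: continuous_intros)
  moreover have "exp c = 1"
    using exp_integer_2pi[of "of_int m"] by (simp add: c_def mult_ac)
  ultimately show ?thesis using False by (simp add: c_def mult_ac)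
qed

text \<open>
  The exponential and the indicator of the cube are products over the coordinates, so that
  the integral factorises.
\<close>

lemma integral_trig:
  fixes k :: "int ^ 'n"
  shows "(LINT x|cube_measure. trig k x) = (if k = 0 then 1 else 0)"
proof -
  let ?h = "\<lambda>(b :: real ^ 'n) t. indicator {0..1::real} t *\<^sub>R exp (2 * complex_of_real pi * \<i> * of_real ((real_vec k \<bullet> b) * t))"
  have factor: "indicator cube x *\<^sub>R trig k x = (\<Prod>b\<in>Basis. ?h b (x \<bullet> b))" for x :: "real ^ 'n"
  proof -
    have "1 \<bullet> b = 1" if "b \<in> Basis" for b :: "real ^ 'n"
      using that by (auto simp: Basis_vec_def inner_axis)
    then have "indicator cube x = (\<Prod>b\<in>Basis. indicator {0..1::real} (x \<bullet> b) :: real)"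
      by (auto simp: cube_def mem_box indicator_def prod_zero_iff)
    moreover have "trig k x = (\<Prod>b\<in>Basis. exp (2 * complex_of_real pi * \<i> * of_real ((real_vec k \<bullet> b) * (x \<bullet> b))))"
      by (simp add: trig_def euclidean_inner[of "real_vec k" x] sum_distrib_left exp_sum)
    ultimately show ?thesis by (simp add: scaleR_conv_of_real prod.distrib)
  qed
  have "(LINT x|cube_measure. trig k x) = (LINT x|lebesgue. indicator cube x *\<^sub>R trig k x)"
    by (rule integral_restrict_space) (simp add: cube_def)
  also have "\<dots> = (LINT x|lborel. indicator cube x *\<^sub>R trig k x)"
  proof (rule integral_completion)
    have "trig k \<in> borel_measurable borel"
      by (intro borel_measurable_continuous_onI continuous_intros)
    then show "(\<lambda>x. indicator cube x *\<^sub>R trig k x) \<in> borel_measurable lborel"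
      by (auto simp: cube_def)
  qed
  also have "\<dots> = (LINT x|lborel. (\<Prod>b\<in>Basis. ?h b (x \<bullet> b)))"
    by (simp only: factor)
  also have "\<dots> = (LINT f|(\<Pi>\<^sub>M b\<in>Basis. lborel). (\<Prod>b\<in>Basis. ?h b (f b)))"
  proof -
    have "(LINT x|lborel. (\<Prod>b\<in>Basis. ?h b (x \<bullet> b)))
        = (LINT f|(\<Pi>\<^sub>M b\<in>Basis. lborel). (\<Prod>b\<in>Basis. ?h b ((\<Sum>c\<in>Basis. f c *\<^sub>R c) \<bullet> b)))"
      by (subst lborel_eq, rule integral_distr) measurable
    also have "\<dots> = (LINT f|(\<Pi>\<^sub>M b\<in>Basis. lborel). (\<Prod>b\<in>Basis. ?h b (f b)))"
      by (intro Bochner_Integration.integral_cong prod.cong refl)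
        (simp add: inner_sum_left inner_Basis if_distrib sum.delta cong: if_cong)
    finally show ?thesis .
  qed
  also have "\<dots> = (\<Prod>b\<in>Basis. LINT t|lborel. ?h b t)"
  proof -
    interpret product_sigma_finite "\<lambda>b :: real ^ 'n. lborel :: real measure"
      by (simp add: product_sigma_finite_def sigma_finite_lborel)
    show ?thesis
      by (rule product_integral_prod)
        (auto intro!: borel_integrable_compact continuous_intros)
  qed
  also have "\<dots> = (\<Prod>b\<in>Basis. if real_vec k \<bullet> b = 0 then 1 else 0)"
  proof (rule prod.cong[OF refl])
    fix b :: "real ^ 'n" assume "b \<in> Basis"
    then obtain i where "b = axis i 1" by (auto simp: Basis_vec_def)
    then have "real_vec k \<bullet> b = real_of_int (k $ i)"
      by (simp add: real_vec_def inner_axis)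
    then show "(LINT t|lborel. ?h b t) = (if real_vec k \<bullet> b = 0 then 1 else 0)"
      using integral_unit_exp[of "k $ i"] by simp
  qed
  also have "\<dots> = (if k = 0 then 1 else 0)"
  proof -
    have "(\<forall>b\<in>Basis. real_vec k \<bullet> b = 0) \<longleftrightarrow> k = 0"
      by (auto simp: euclidean_all_zero_iff real_vec_def vec_eq_iff)
    then show ?thesis by (auto simp: prod_zero_iff)
  qed
  finally show ?thesis .
qed

lemma trig_orthonormal: "L2_inner (trig k) (trig l) = (if k = l then 1 else 0)"
  by (simp add: L2_inner_def cnj_trig integral_trig flip: trig_add)

text \<open>
  The inductive form gives closure under products and the reduction of orthogonality to finitely
  many frequencies by rule induction, without bookkeeping of coefficient families.
\<close>

inductive trig_polynomial :: "(real ^ 'n \<Rightarrow> complex) \<Rightarrow> bool" where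
  monomial: "trig_polynomial (\<lambda>x. a * trig k x)"
| add: "trig_polynomial f \<Longrightarrow> trig_polynomial g \<Longrightarrow> trig_polynomial (\<lambda>x. f x + g x)"

lemma trig_polynomial_const: "trig_polynomial (\<lambda>x. a)"
  using trig_polynomial.monomial[of a 0] by simp

lemma trig_polynomial_sum:
  "(\<And>i. i \<in> I \<Longrightarrow> trig_polynomial (f i)) \<Longrightarrow> trig_polynomial (\<lambda>x. \<Sum>i\<in>I. f i x)"
  by (induction I rule: infinite_finite_induct)
    (auto intro: trig_polynomial_const trig_polynomial.add)

lemma trig_polynomial_mult:
  assumes "trig_polynomial f" "trig_polynomial g"
  shows "trig_polynomial (\<lambda>x. f x * g x)"
  using assms(1)
proof induction
  case (monomial a k)
  show ?case using assms(2)
  proof induction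
    case (monomial b l)
    show ?case
      using trig_polynomial.monomial[of "a * b" "k + l"] by (simp add: trig_add mult_ac)
  qed (simp add: distrib_left trig_polynomial.add)
qed (simp add: distrib_right trig_polynomial.add)

lemma trig_polynomial_scale: "trig_polynomial f \<Longrightarrow> trig_polynomial (\<lambda>x. a * f x)"
  by (rule trig_polynomial_mult[OF trig_polynomial_const])

lemma trig_polynomial_L2: "trig_polynomial f \<Longrightarrow> f \<in> L2"
  by (induction rule: trig_polynomial.induct) (auto intro: L2_scale L2_add trig_L2)

text \<open>
  Orthogonality to a trigonometric polynomial only has to be tested on a finite set of characters,
  whatever the function. This is how an approximating polynomial is used in \<open>Parseval_bound\<close>.
\<close>

lemma trig_polynomial_finite_frequencies:
  assumes "trig_polynomial f"
  shows "\<exists>K. finite K \<and> (\<forall>g\<in>L2. (\<forall>k\<in>K. L2_inner g (trig k) = 0) \<longrightarrow> L2_inner g f = 0)"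
  using assms
proof induction
  case (monomial a k)
  then show ?case
    by (intro exI[of _ "{k}"]) (simp add: L2_inner_scale_right)
next
  case (add f f')
  then obtain K K' where "finite K" "finite K'"
    and K: "\<forall>g\<in>L2. (\<forall>k\<in>K. L2_inner g (trig k) = 0) \<longrightarrow> L2_inner g f = 0"
    and K': "\<forall>g\<in>L2. (\<forall>k\<in>K'. L2_inner g (trig k) = 0) \<longrightarrow> L2_inner g f' = 0"
    by blast
  then show ?case
    using add.hyps
    by (intro exI[of _ "K \<union> K'"]) (auto simp: L2_inner_add_right trig_polynomial_L2)
qed

section \<open>Density of the trigonometric polynomials\<close>

text \<open>
  The quotient map from the cube onto the torus, embedded in $\mathbb{C}^d$. It turns
  polynomials in the real and imaginary parts of the coordinates into trigonometric polynomials.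
\<close>

definition torus_map :: "real ^ 'n \<Rightarrow> complex ^ 'n" where
  "torus_map x = (\<chi> i. trig (axis i 1) x)"

lemma continuous_on_torus_map: "continuous_on S torus_map"
  unfolding torus_map_def by (intro continuous_intros)

text \<open>
  The torus map only identifies boundary points with each other: two preimages of a point
  differ by integers in each coordinate, and an interior point differs by less than one from
  every point of the cube in each coordinate.
\<close>

lemma torus_map_eq_imp_eq:
  fixes x c :: "real ^ 'n"
  assumes eq: "torus_map x = torus_map c" and x: "x \<in> cube" and c: "c \<in> box 0 1"
  shows "x = c"
proof (subst vec_eq_iff, rule allI)
  fix i
  have coord: "real_vec (axis i 1 :: int ^ 'n) \<bullet> z = z $ i" for z :: "real ^ 'n"
  proof -
    have "real_vec (axis i 1 :: int ^ 'n) = axis i 1"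
      by (simp add: real_vec_def axis_def vec_eq_iff)
    then show ?thesis by (simp add: inner_axis')
  qed
  have "trig (axis i 1) x = trig (axis i 1) c"
    using eq by (simp add: torus_map_def vec_eq_iff)
  then obtain m :: int where
    "2 * complex_of_real pi * \<i> * of_real (x $ i)
      = 2 * complex_of_real pi * \<i> * of_real (c $ i) + of_int (2 * m) * of_real pi * \<i>"
    by (auto simp: trig_def coord exp_eq)
  then have "2 * pi * (x $ i) = 2 * pi * (c $ i) + 2 * of_int m * pi"
    by (auto simp: complex_eq_iff)
  then have "2 * pi * (x $ i) = 2 * pi * (c $ i + of_int m)"
    by (simp add: algebra_simps)
  then have m: "x $ i = c $ i + of_int m" by simp
  have "0 \<le> x $ i" "x $ i \<le> 1" "0 < c $ i" "c $ i < 1"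
    using x c by (auto simp: cube_def mem_box_cart)
  then have "-1 < real_of_int m" "real_of_int m < 1" using m by linarith+
  then have "m = 0" by linarith
  then show "x $ i = c $ i" using m by simp
qed

text \<open>
  By induction it suffices to look at linear functions, hence at the coordinates
  $\mathrm{Re}\,e^{2\pi ix_j}$ and $\mathrm{Im}\,e^{2\pi ix_j}$, which combine two characters.
\<close>

lemma trig_polynomial_polynomial_torus_map:
  assumes "real_polynomial_function p"
  shows "trig_polynomial (\<lambda>x. complex_of_real (p (torus_map x)))"
  using assms
proof induction
  case (linear f)
  interpret bounded_linear f by fact
  have coord: "trig_polynomial (\<lambda>x. complex_of_real (torus_map x \<bullet> b))" if "b \<in> Basis" for b :: "complex ^ 'a"
  proof -
    from that obtain i u where b: "b = axis i u" and u: "u = 1 \<or> u = \<i>"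
      by (auto simp: Basis_vec_def Basis_complex_def)
    let ?t = "trig (axis i 1 :: int ^ 'a)" and ?s = "trig (- axis i 1 :: int ^ 'a)"
    have inner: "torus_map x \<bullet> b = ?t x \<bullet> u" for x
      by (simp add: b inner_axis torus_map_def)
    from u show ?thesis
    proof
      assume [simp]: "u = 1"
      have "complex_of_real (torus_map x \<bullet> b) = 1 / 2 * ?t x + 1 / 2 * ?s x" for x
        unfolding inner cnj_trig[symmetric] by (simp add: complex_eq_iff inner_complex_def)
      then show ?thesis by (simp only: trig_polynomial.intros)
    next
      assume [simp]: "u = \<i>"
      have "complex_of_real (torus_map x \<bullet> b) = - \<i> / 2 * ?t x + \<i> / 2 * ?s x" for x
        unfolding inner cnj_trig[symmetric] by (simp add: complex_eq_iff inner_complex_def)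
      then show ?thesis by (simp only: trig_polynomial.intros)
    qed
  qed
  have "complex_of_real (f (torus_map x))
      = (\<Sum>b\<in>Basis. complex_of_real (f b) * complex_of_real (torus_map x \<bullet> b))" for x
  proof -
    have "f (torus_map x) = f (\<Sum>b\<in>Basis. (torus_map x \<bullet> b) *\<^sub>R b)"
      by (simp add: euclidean_representation)
    then show ?thesis by (simp add: sum scaleR mult.commute)
  qed
  then show ?case
    by (simp only:) (intro trig_polynomial_sum trig_polynomial_scale coord)
next
  case (const c)
  show ?case by (rule trig_polynomial_const)
qed (simp_all add: trig_polynomial.add trig_polynomial_mult)

definition trig_approximable :: "(real ^ 'n \<Rightarrow> complex) \<Rightarrow> bool" where
  "trig_approximable f \<longleftrightarrow>
     f \<in> L2 \<and> (\<forall>e>0. \<exists>T. trig_polynomial T \<and> L2_norm (\<lambda>x. f x - T x) < e)"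

lemma trig_approximable_limit:
  assumes f: "f \<in> L2"
    and lim: "\<And>e. e > 0 \<Longrightarrow> \<exists>g. trig_approximable g \<and> L2_norm (\<lambda>x. f x - g x) < e"
  shows "trig_approximable f"
  unfolding trig_approximable_def
proof (intro conjI allI impI)
  fix e :: real assume "e > 0"
  then obtain g where g: "trig_approximable g" "L2_norm (\<lambda>x. f x - g x) < e / 2"
    using lim[of "e / 2"] by auto
  then obtain T where T: "trig_polynomial T" "L2_norm (\<lambda>x. g x - T x) < e / 2"
    using \<open>e > 0\<close> unfolding trig_approximable_def by (meson half_gt_zero)
  have "L2_norm (\<lambda>x. f x - T x) \<le> L2_norm (\<lambda>x. f x - g x) + L2_norm (\<lambda>x. g x - T x)"
    using f g T by (intro L2_norm_triangle_diff) (auto simp: trig_approximable_def trig_polynomial_L2)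
  also have "\<dots> < e" using g T by simp
  finally show "\<exists>T. trig_polynomial T \<and> L2_norm (\<lambda>x. f x - T x) < e" using T by blast
qed (rule f)

lemma trig_approximable_LIMSEQ:
  assumes "f \<in> L2" "\<And>m. trig_approximable (g m)"
    and lim: "(\<lambda>m. L2_norm (\<lambda>x. f x - g m x)) \<longlonglongrightarrow> 0"
  shows "trig_approximable f"
proof (rule trig_approximable_limit[OF assms(1)])
  fix e :: real assume "e > 0"
  then have "eventually (\<lambda>m. L2_norm (\<lambda>x. f x - g m x) < e) sequentially"
    by (rule order_tendstoD(2)[OF lim])
  then show "\<exists>g. trig_approximable g \<and> L2_norm (\<lambda>x. f x - g x) < e"
    using assms(2) by (meson eventually_happens trivial_limit_sequentially)
qed

lemma trig_approximable_cong_AE: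
  assumes "trig_approximable g" "f \<in> L2" "AE x in cube_measure. f x = g x"
  shows "trig_approximable f"
proof (rule trig_approximable_limit[OF assms(2)])
  have "g \<in> L2" using assms by (simp add: trig_approximable_def)
  then have "L2_norm (\<lambda>x. f x - g x) = 0"
    using assms by (simp add: L2_norm_eq_0_iff L2_diff)
  then show "\<exists>g. trig_approximable g \<and> L2_norm (\<lambda>x. f x - g x) < e" if "e > 0" for e
    using assms(1) that by auto
qed

lemma trig_approximable_scale:
  assumes f: "trig_approximable f"
  shows "trig_approximable (\<lambda>x. a * f x)"
  unfolding trig_approximable_def
proof (intro conjI allI impI)
  show "(\<lambda>x. a * f x) \<in> L2"
    using f by (simp add: trig_approximable_def L2_scale)
  fix e :: real assume "e > 0"
  \<comment> \<open>one is added because \<open>a\<close> may vanish\<close>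
  then have "e / (cmod a + 1) > 0" by (simp add: add_nonneg_pos)
  then obtain T where T: "trig_polynomial T" "L2_norm (\<lambda>x. f x - T x) < e / (cmod a + 1)"
    using f by (auto simp: trig_approximable_def)
  have "L2_norm (\<lambda>x. a * f x - a * T x) = cmod a * L2_norm (\<lambda>x. f x - T x)"
    using L2_norm_scale[of a "\<lambda>x. f x - T x"] by (simp add: right_diff_distrib)
  also have "\<dots> \<le> (cmod a + 1) * L2_norm (\<lambda>x. f x - T x)"
    by (intro mult_right_mono) auto
  also have "\<dots> < e" using T by (simp add: pos_less_divide_eq add_nonneg_pos mult.commute)
  finally show "\<exists>T. trig_polynomial T \<and> L2_norm (\<lambda>x. a * f x - T x) < e"
    using T trig_polynomial_scale by blast
qed

lemma trig_approximable_add: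
  assumes "trig_approximable f" "trig_approximable g"
  shows "trig_approximable (\<lambda>x. f x + g x)"
  unfolding trig_approximable_def
proof (intro conjI allI impI)
  have L2: "f \<in> L2" "g \<in> L2" using assms by (auto simp: trig_approximable_def)
  then show "(\<lambda>x. f x + g x) \<in> L2" by (rule L2_add)
  fix e :: real assume "e > 0"
  then obtain T S where T: "trig_polynomial T" "L2_norm (\<lambda>x. f x - T x) < e / 2"
    and S: "trig_polynomial S" "L2_norm (\<lambda>x. g x - S x) < e / 2"
    using assms unfolding trig_approximable_def by (meson half_gt_zero)
  have "L2_norm (\<lambda>x. f x + g x - (T x + S x)) \<le> L2_norm (\<lambda>x. f x - T x) + L2_norm (\<lambda>x. g x - S x)"
    using L2_norm_triangle[of "\<lambda>x. f x - T x" "\<lambda>x. g x - S x"] L2 T S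
    by (simp add: L2_diff trig_polynomial_L2 algebra_simps)
  also have "\<dots> < e" using T S by simp
  finally show "\<exists>T. trig_polynomial T \<and> L2_norm (\<lambda>x. f x + g x - T x) < e"
    using T S trig_polynomial.add by blast
qed

lemma trig_approximable_sum:
  assumes "\<And>i. i \<in> I \<Longrightarrow> trig_approximable (f i)"
  shows "trig_approximable (\<lambda>x. \<Sum>i\<in>I. f i x)"
proof -
  have zero: "trig_approximable (\<lambda>x. 0)"
    unfolding trig_approximable_def
    by (auto simp: L2_zero L2_norm_def intro!: exI[of _ "\<lambda>x. 0"] trig_polynomial_const)
  show ?thesis
    using assms
    by (induction I rule: infinite_finite_induct) (auto intro: zero trig_approximable_add)
qed

lemma measure_cube: "measure cube_measure (cube :: (real ^ 'n) set) = 1"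
proof -
  have "(1 :: real ^ 'n) \<bullet> b = 1" if "b \<in> Basis" for b
    using that by (auto simp: Basis_vec_def inner_axis)
  then show ?thesis
    by (simp add: measure_restrict_space cube_def measure_completion)
qed

lemma L2_norm_le_bound:
  fixes f :: "real ^ 'n \<Rightarrow> complex"
  assumes f: "f \<in> L2" and le: "\<And>x. x \<in> cube \<Longrightarrow> cmod (f x) \<le> C" and C: "C \<ge> 0"
  shows "L2_norm f \<le> C"
proof (rule power2_le_imp_le)
  interpret finite_measure cube_measure by (rule finite_cube_measure)
  have "(L2_norm f)\<^sup>2 \<le> (LINT x|(cube_measure :: (real ^ 'n) measure). C\<^sup>2)"
    unfolding L2_norm_square
  proof (rule Bochner_Integration.integral_mono)
    show "(cmod (f x))\<^sup>2 \<le> C\<^sup>2" if "x \<in> space cube_measure" for x :: "real ^ 'n"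
      using le[of x] that by (auto intro: power_mono)
  qed (auto intro: L2_square_integrable f)
  then show "(L2_norm f)\<^sup>2 \<le> C\<^sup>2" by (simp add: measure_cube)
qed (rule C)

text \<open>
  Stone--Weierstrass on the image of the cube, which is compact; uniform approximation there
  implies approximation in $L^2$ because the cube has measure one.
\<close>

lemma trig_approximable_continuous_torus_map:
  fixes G :: "complex ^ 'n \<Rightarrow> real"
  assumes G: "continuous_on UNIV G"
  shows "trig_approximable (\<lambda>x. complex_of_real (G (torus_map x)))"
  unfolding trig_approximable_def
proof (intro conjI allI impI)
  have "continuous_on cube (\<lambda>x. complex_of_real (G (torus_map x)))"
    by (intro continuous_intros continuous_on_torus_map continuous_on_compose2[OF G]) auto
  then have meas: "(\<lambda>x. complex_of_real (G (torus_map x))) \<in> borel_measurable cube_measure"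
    by (rule continuous_on_cube_measurable)
  have cube: "compact (cube :: (real ^ 'n) set)" by (simp add: cube_def compact_cbox)
  have K: "compact (torus_map ` (cube :: (real ^ 'n) set))"
    by (intro compact_continuous_image continuous_on_torus_map cube)
  have "bounded (G ` torus_map ` (cube :: (real ^ 'n) set))"
    by (intro compact_imp_bounded compact_continuous_image K continuous_on_subset[OF G]) auto
  then obtain C where "\<And>x :: real ^ 'n. x \<in> cube \<Longrightarrow> \<bar>G (torus_map x)\<bar> \<le> C"
    by (auto simp: bounded_iff)
  then show L2: "(\<lambda>x. complex_of_real (G (torus_map x))) \<in> L2"
    by (intro L2_bounded[OF meas, where C = C] AE_I2) simp
  fix e :: real assume "e > 0"
  then obtain p where p: "polynomial_function p"
    and le: "\<And>z. z \<in> torus_map ` (cube :: (real ^ 'n) set) \<Longrightarrow> \<bar>G z - p z\<bar> < e / 2"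
    using Stone_Weierstrass_polynomial_function[OF K continuous_on_subset[OF G], of "e / 2"] by auto
  have T: "trig_polynomial (\<lambda>x. complex_of_real (p (torus_map x)))"
    using p by (simp add: trig_polynomial_polynomial_torus_map real_polynomial_function_eq)
  have "L2_norm (\<lambda>x. complex_of_real (G (torus_map x)) - complex_of_real (p (torus_map x))) \<le> e / 2"
  proof (rule L2_norm_le_bound)
    fix x :: "real ^ 'n" assume "x \<in> cube"
    then have "\<bar>G (torus_map x) - p (torus_map x)\<bar> \<le> e / 2"
      using le by (simp add: less_imp_le)
    then show "cmod (complex_of_real (G (torus_map x)) - complex_of_real (p (torus_map x))) \<le> e / 2"
      by (simp flip: of_real_diff)
  qed (use L2 T \<open>e > 0\<close> in \<open>auto intro: L2_diff trig_polynomial_L2\<close>)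
  then show "\<exists>T. trig_polynomial T \<and> L2_norm (\<lambda>x. complex_of_real (G (torus_map x)) - T x) < e"
    using T \<open>e > 0\<close> by (intro exI[of _ "\<lambda>x. complex_of_real (p (torus_map x))"]) auto
qed

lemma L2_norm_dominated_convergence:
  assumes f: "f \<in> borel_measurable cube_measure" and s: "\<And>m. s m \<in> borel_measurable cube_measure"
    and w: "w \<in> L2"
    and bound: "\<And>m x. x \<in> cube \<Longrightarrow> cmod (f x - s m x) \<le> cmod (w x)"
    and lim: "\<And>x. x \<in> cube \<Longrightarrow> (\<lambda>m. s m x) \<longlonglongrightarrow> f x"
  shows "(\<lambda>m. L2_norm (\<lambda>x. f x - s m x)) \<longlonglongrightarrow> 0"
proof -
  note [measurable] = f s
  have "(\<lambda>m. LINT x|cube_measure. (cmod (f x - s m x))\<^sup>2) \<longlonglongrightarrow> (LINT x|(cube_measure :: (real ^ 'a) measure). 0)"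
  proof (rule integral_dominated_convergence)
    show "integrable cube_measure (\<lambda>x. (cmod (w x))\<^sup>2)" by (rule L2_square_integrable[OF w])
    show "AE x in cube_measure. norm ((cmod (f x - s m x))\<^sup>2) \<le> (cmod (w x))\<^sup>2" for m
      using bound by (intro AE_I2) (auto intro!: power_mono)
    show "AE x in cube_measure. (\<lambda>m. (cmod (f x - s m x))\<^sup>2) \<longlonglongrightarrow> 0"
    proof (rule AE_I2)
      fix x assume "x \<in> space (cube_measure :: (real ^ 'a) measure)"
      then have "(\<lambda>m. (cmod (f x - s m x))\<^sup>2) \<longlonglongrightarrow> (cmod (f x - f x))\<^sup>2"
        by (intro tendsto_intros lim) simp
      then show "(\<lambda>m. (cmod (f x - s m x))\<^sup>2) \<longlonglongrightarrow> 0" by simp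
    qed
  qed measurable
  then show ?thesis
    unfolding L2_norm_def using tendsto_real_sqrt by fastforce
qed

text \<open>
  The indicator of a compact set $C$ in the open cube is the bounded pointwise limit of
  $\max(0,1-m\,\mathrm{dist}(\cdot,K))$ composed with the torus map, where $K$ is the image of $C$.
  Points outside $C$ have positive distance to $K$ because the torus map
  sends no other point of the cube to the image of a point of $C$.
\<close>

lemma trig_approximable_compact:
  fixes C :: "(real ^ 'n) set"
  assumes C: "compact C" "C \<subseteq> box 0 1"
  shows "trig_approximable (\<lambda>x. complex_of_real (indicator C x))"
proof (cases "C = {}")
  case True
  then show ?thesis using trig_approximable_sum[of "{} :: nat set" "\<lambda>i x. 0"] by simp
next
  case False
  define K where "K = torus_map ` C"
  have K: "closed K" "K \<noteq> {}"
    using C False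
    by (auto simp: K_def intro!: compact_imp_closed compact_continuous_image continuous_on_torus_map)
  define s where "s = (\<lambda>m x. complex_of_real (max 0 (1 - real m * infdist (torus_map x) K)))"
  have approx: "trig_approximable (s m)" for m
    unfolding s_def
    by (rule trig_approximable_continuous_torus_map[where G = "\<lambda>z. max 0 (1 - real m * infdist z K)"])
      (intro continuous_intros)
  have "C \<in> sets lebesgue" using C by (simp add: compact_imp_closed)
  moreover have "C \<subseteq> cube" using C box_subset_cbox by (auto simp: cube_def)
  ultimately have "C \<in> sets cube_measure"
    by (simp add: sets_restrict_space_iff cube_def)
  then have ind: "(\<lambda>x. complex_of_real (indicator C x)) \<in> borel_measurable cube_measure"
    by measurable
  show ?thesis
  proof (rule trig_approximable_LIMSEQ)
    show "(\<lambda>x. complex_of_real (indicator C x)) \<in> L2"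
      by (rule L2_bounded[OF ind, where C = 1]) (simp add: indicator_def)
    show "trig_approximable (s m)" for m by (rule approx)
    show "(\<lambda>m. L2_norm (\<lambda>x. complex_of_real (indicator C x) - s m x)) \<longlonglongrightarrow> 0"
    proof (rule L2_norm_dominated_convergence[OF ind])
      show "s m \<in> borel_measurable cube_measure" for m
        using approx by (simp add: trig_approximable_def L2_measurable)
      show "(\<lambda>x. 1) \<in> L2" by (rule L2_bounded[where C = 1]) auto
      show "cmod (complex_of_real (indicator C x) - s m x) \<le> cmod 1" for m x
        by (auto simp: s_def indicator_def infdist_nonneg simp flip: of_real_diff)
      fix x :: "real ^ 'n" assume x: "x \<in> cube"
      show "(\<lambda>m. s m x) \<longlonglongrightarrow> complex_of_real (indicator C x)"
      proof (cases "x \<in> C")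
        case True
        then have "infdist (torus_map x) K = 0" by (simp add: K_def)
        then show ?thesis using True by (simp add: s_def)
      next
        case False
        have "torus_map x \<notin> K"
          using torus_map_eq_imp_eq[OF _ x] C(2) False by (auto simp: K_def)
        then have d: "infdist (torus_map x) K > 0"
          by (rule infdist_pos_not_in_closed[OF K])
        obtain M where M: "1 < real M * infdist (torus_map x) K"
          using reals_Archimedean3[OF d] by blast
        have "s m x = 0" if "m \<ge> M" for m
        proof -
          have "real M * infdist (torus_map x) K \<le> real m * infdist (torus_map x) K"
            using that d by (intro mult_right_mono) auto
          then show ?thesis using M by (simp add: s_def)
        qed
        then have "eventually (\<lambda>m. s m x = 0) sequentially"
          by (auto simp: eventually_sequentially)
        then show ?thesis using False by (simp add: tendsto_eventually)
      qed
    qed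
  qed
qed

lemma L2_norm_indicator:
  assumes "D \<in> sets cube_measure"
  shows "L2_norm (\<lambda>x. complex_of_real (indicator D x)) = sqrt (measure cube_measure D)"
proof -
  have "(cmod (complex_of_real (indicator D x)))\<^sup>2 = indicator D x" for x
    by (simp add: indicator_def)
  moreover have "D \<inter> cube = D" using sets.sets_into_space[OF assms] by auto
  ultimately show ?thesis using assms by (simp add: L2_norm_def)
qed

text \<open>
  Removing the boundary changes a set by a null set, and inner regularity then provides a compact
  subset of almost full measure.
\<close>

lemma trig_approximable_indicator:
  fixes A :: "(real ^ 'n) set"
  assumes A: "A \<in> sets cube_measure"
  shows "trig_approximable (\<lambda>x. complex_of_real (indicator A x))"
proof -
  have indicator_L2: "(\<lambda>x. complex_of_real (indicator D x)) \<in> L2" if "D \<in> sets cube_measure" for D :: "(real ^ 'n) set"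
    by (rule L2_bounded[where C = 1]) (use that in \<open>auto simp: indicator_def\<close>)
  have sets_iff: "D \<in> sets cube_measure \<longleftrightarrow> D \<in> sets lebesgue \<and> D \<subseteq> cube" for D :: "(real ^ 'n) set"
    by (auto simp: sets_restrict_space_iff cube_def)
  define A' where "A' = A \<inter> box 0 1"
  have A': "A' \<in> sets lebesgue" "A' \<subseteq> cube" using A by (auto simp: A'_def sets_iff)
  have "trig_approximable (\<lambda>x. complex_of_real (indicator A' x))"
  proof (rule trig_approximable_limit)
    show "(\<lambda>x. complex_of_real (indicator A' x)) \<in> L2"
      using A' by (intro indicator_L2) (simp add: sets_iff)
    fix e :: real assume "e > 0"
    then obtain C where C: "closed C" "C \<subseteq> A'" "A' - C \<in> lmeasurable"
      and small: "emeasure lebesgue (A' - C) < ennreal (e\<^sup>2)"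
      using sets_lebesgue_inner_closed[OF A'(1), of "e\<^sup>2"] by auto
    have D: "A' - C \<in> sets cube_measure" using A' C by (auto simp: sets_iff)
    have "compact C"
      using C A' by (auto simp: compact_eq_bounded_closed cube_def intro: bounded_subset[OF bounded_cbox])
    have "(\<lambda>x. complex_of_real (indicator A' x) - complex_of_real (indicator C x))
        = (\<lambda>x. complex_of_real (indicator (A' - C) x))"
      using C(2) by (auto simp: indicator_def fun_eq_iff)
    then have "L2_norm (\<lambda>x. complex_of_real (indicator A' x) - complex_of_real (indicator C x))
        = sqrt (measure cube_measure (A' - C))"
      using D by (simp add: L2_norm_indicator)
    also have "measure cube_measure (A' - C) = measure lebesgue (A' - C)"
      using A' by (intro measure_restrict_space) (auto simp: cube_def)
    also have "sqrt \<dots> < sqrt (e\<^sup>2)"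
      using small C(3) by (intro real_sqrt_less_mono) (simp add: emeasure_eq_measure2 ennreal_less_iff)
    finally have "L2_norm (\<lambda>x. complex_of_real (indicator A' x) - complex_of_real (indicator C x)) < e"
      using \<open>e > 0\<close> by simp
    then show "\<exists>g. trig_approximable g \<and> L2_norm (\<lambda>x. complex_of_real (indicator A' x) - g x) < e"
      using trig_approximable_compact[OF \<open>compact C\<close>] C(2) unfolding A'_def by blast
  qed
  then show ?thesis
  proof (rule trig_approximable_cong_AE)
    show "(\<lambda>x. complex_of_real (indicator A x)) \<in> L2" by (rule indicator_L2[OF A])
    have "cbox 0 1 - box 0 1 \<in> null_sets (lebesgue :: (real ^ 'n) measure)"
      using negligible_frontier_interval negligible_iff_null_sets by blast
    then have "AE x in lebesgue. x \<notin> cbox 0 1 - box 0 (1 :: real ^ 'n)" by (rule AE_not_in)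
    then have "AE x in lebesgue. x \<in> cube \<longrightarrow> complex_of_real (indicator A x) = complex_of_real (indicator A' x)"
      by eventually_elim (auto simp: A'_def cube_def indicator_def)
    then show "AE x in cube_measure. complex_of_real (indicator A x) = complex_of_real (indicator A' x)"
      by (subst AE_restrict_space_iff) (auto simp: cube_def)
  qed
qed

text \<open>
  Simple functions are combinations of indicators and approximate $f$ pointwise with a multiple
  of $|f|$ as a majorant.
\<close>

lemma trig_approximable_L2:
  fixes f :: "real ^ 'n \<Rightarrow> complex"
  assumes f: "f \<in> L2"
  shows "trig_approximable f"
proof -
  obtain s where s: "\<forall>m. simple_function cube_measure (s m)"
    and lim: "\<forall>x\<in>space cube_measure. (\<lambda>m. s m x) \<longlonglongrightarrow> f x"
    and bound: "\<forall>m. \<forall>x\<in>space cube_measure. dist (s m x) 0 \<le> 2 * dist (f x) 0"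
    using borel_measurable_implies_sequence_metric[OF L2_measurable[OF f], of 0] by blast
  note s = s[rule_format]
  have lim: "(\<lambda>m. s m x) \<longlonglongrightarrow> f x" if "x \<in> cube" for x using lim that by simp
  have bound: "cmod (s m x) \<le> 2 * cmod (f x)" if "x \<in> cube" for m x using bound that by simp
  have s_L2: "s m \<in> L2" for m
    by (rule L2_dominated[OF borel_measurable_simple_function[OF s] f, where C = 2])
      (use bound in \<open>auto intro!: AE_I2\<close>)
  show ?thesis
  proof (rule trig_approximable_LIMSEQ[OF f])
    fix m
    have "trig_approximable (\<lambda>x. \<Sum>v\<in>s m ` cube. v * complex_of_real (indicator (s m -` {v} \<inter> cube) x))"
    proof (rule trig_approximable_sum)
      fix v
      have "s m -` {v} \<inter> cube \<in> sets cube_measure"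
        using simple_functionD(2)[OF s[of m], of "{v}"] by simp
      then show "trig_approximable (\<lambda>x. v * complex_of_real (indicator (s m -` {v} \<inter> cube) x))"
        by (rule trig_approximable_scale[OF trig_approximable_indicator])
    qed
    then show "trig_approximable (s m)"
    proof (rule trig_approximable_cong_AE[OF _ s_L2])
      have sum: "s m x = (\<Sum>v\<in>s m ` cube. v * complex_of_real (indicator (s m -` {v} \<inter> cube) x))"
        if "x \<in> cube" for x
      proof -
        have "v * complex_of_real (indicator (s m -` {v} \<inter> cube) x) = (if s m x = v then v else 0)" for v
          using that by simp
        moreover have "finite (s m ` cube)" using simple_functionD(1)[OF s[of m]] by simp
        ultimately show ?thesis using that by (simp only: sum.delta') simp
      qed
      show "AE x in cube_measure. s m x
          = (\<Sum>v\<in>s m ` cube. v * complex_of_real (indicator (s m -` {v} \<inter> cube) x))"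
        by (rule AE_I2, rule sum) simp
    qed
  next
    show "(\<lambda>m. L2_norm (\<lambda>x. f x - s m x)) \<longlonglongrightarrow> 0"
    proof (rule L2_norm_dominated_convergence[OF L2_measurable[OF f] borel_measurable_simple_function[OF s] L2_scale[OF f, of 3] _ lim])
      fix m and x :: "real ^ 'n" assume "x \<in> cube"
      then show "cmod (f x - s m x) \<le> cmod (3 * f x)"
        using bound[of x m] norm_triangle_ineq4[of "f x" "s m x"] by (simp add: norm_mult)
    qed
  qed
qed

text \<open>
  This is the nontrivial half of Parseval's identity. Choose a trigonometric polynomial $T$ close
  to $h$ and let $S$ be the partial Fourier sum over the frequencies of $T$. The error $g=h-S$ is
  orthogonal to both $S$ and $T$, so $\|g\|^2=\langle g,h-T\rangle$ is small, while $\|S\|^2$ is a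
  finite sum of squared coefficients.
\<close>

lemma Parseval_bound:
  assumes h: "h \<in> L2"
    and C: "\<And>K. finite K \<Longrightarrow> (\<Sum>k\<in>K. (cmod (L2_inner h (trig k)))\<^sup>2) \<le> C"
  shows "(L2_norm h)\<^sup>2 \<le> C"
proof (rule field_le_epsilon)
  fix d :: real assume "d > 0"
  define e where "e = sqrt d"
  have e: "e > 0" "e\<^sup>2 = d" using \<open>d > 0\<close> by (auto simp: e_def)
  obtain T where T: "trig_polynomial T" and close: "L2_norm (\<lambda>x. h x - T x) < e"
    using trig_approximable_L2[OF h] e by (auto simp: trig_approximable_def)
  obtain K where K: "finite K"
    and orth_T: "\<And>g. g \<in> L2 \<Longrightarrow> (\<And>k. k \<in> K \<Longrightarrow> L2_inner g (trig k) = 0) \<Longrightarrow> L2_inner g T = 0"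
    using trig_polynomial_finite_frequencies[OF T] by blast
  define S where "S = (\<lambda>x. \<Sum>k\<in>K. L2_inner h (trig k) * trig k x)"
  define g where "g = (\<lambda>x. h x - S x)"
  have T_L2: "T \<in> L2" by (rule trig_polynomial_L2[OF T])
  have S_L2: "S \<in> L2" unfolding S_def by (intro L2_sum L2_scale trig_L2)
  have g_L2: "g \<in> L2" unfolding g_def by (intro L2_diff h S_L2)
  have S_coeff: "L2_inner S (trig k) = L2_inner h (trig k)" if "k \<in> K" for k
    using that K
    by (simp add: S_def L2_inner_sum_left L2_inner_scale_left trig_orthonormal L2_scale trig_L2
        if_distrib cong: if_cong)
  have orth: "L2_inner g (trig k) = 0" if "k \<in> K" for k
    using S_coeff[OF that] by (simp add: g_def L2_inner_diff_left h S_L2 trig_L2)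
  have orth_S: "L2_inner g S = 0"
    unfolding S_def
    by (simp add: L2_inner_sum_right L2_inner_scale_right L2_scale trig_L2 g_L2 orth)
  have norm_S: "(L2_norm S)\<^sup>2 = (\<Sum>k\<in>K. (cmod (L2_inner h (trig k)))\<^sup>2)"
  proof -
    have "L2_inner S S = (\<Sum>k\<in>K. cnj (L2_inner h (trig k)) * L2_inner S (trig k))"
      by (subst (2) S_def) (simp add: L2_inner_sum_right L2_inner_scale_right L2_scale trig_L2 S_L2)
    also have "\<dots> = of_real (\<Sum>k\<in>K. (cmod (L2_inner h (trig k)))\<^sup>2)"
      unfolding of_real_sum complex_norm_square by (intro sum.cong) (simp_all add: S_coeff mult.commute)
    finally show ?thesis unfolding L2_inner_self of_real_eq_iff .
  qed
  \<comment> \<open>orthogonality to the partial sum and to the approximating polynomial\<close>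
  have "L2_norm g \<le> e"
  proof -
    have "(L2_norm g)\<^sup>2 = Re (L2_inner g g)" by (simp add: L2_inner_self)
    also have "L2_inner g g = L2_inner g h - L2_inner g S"
      by (subst (2) g_def) (simp add: L2_inner_diff_right h S_L2 g_L2)
    also have "\<dots> = L2_inner g (\<lambda>x. h x - T x)"
      using orth_T[OF g_L2 orth] orth_S by (simp add: L2_inner_diff_right h T_L2 g_L2)
    also have "Re \<dots> \<le> L2_norm g * L2_norm (\<lambda>x. h x - T x)"
      by (rule order_trans[OF complex_Re_le_cmod L2_Cauchy_Schwarz]) (intro g_L2 L2_diff h T_L2)+
    also have "\<dots> \<le> L2_norm g * e" using close by (intro mult_left_mono) auto
    finally have "L2_norm g * L2_norm g \<le> L2_norm g * e" by (simp add: power2_eq_square)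
    then show ?thesis
      using e(1) L2_norm_nonneg[of g] by (cases "L2_norm g = 0") (auto simp: mult_le_cancel_left)
  qed
  then have "(L2_norm g)\<^sup>2 \<le> d" unfolding e(2)[symmetric] by (intro power_mono) auto
  moreover have "(L2_norm h)\<^sup>2 = (L2_norm g)\<^sup>2 + (L2_norm S)\<^sup>2"
    using L2_norm_add_square[OF g_L2 S_L2] orth_S by (simp add: g_def)
  ultimately show "(L2_norm h)\<^sup>2 \<le> C + d" using C[OF K] norm_S by simp
qed

section \<open>Projections onto bounded sets in finite-dimensional subspaces\<close>

lemma Linf_norm_le_iff:
  assumes "f \<in> borel_measurable cube_measure"
  shows "Linf_norm f \<le> ereal R \<longleftrightarrow> (AE x in cube_measure. cmod (f x) \<le> R)"
proof
  assume le: "Linf_norm f \<le> ereal R"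
  have "AE x in cube_measure. ereal (cmod (f x)) \<le> Linf_norm f"
    unfolding Linf_norm_def by (rule esssup_AE)
  then show "AE x in cube_measure. cmod (f x) \<le> R"
  proof eventually_elim
    case (elim x)
    then have "ereal (cmod (f x)) \<le> ereal R" using le by (rule order_trans)
    then show ?case by simp
  qed
next
  assume "AE x in cube_measure. cmod (f x) \<le> R"
  then show "Linf_norm f \<le> ereal R"
    unfolding Linf_norm_def using assms by (intro esssup_I) auto
qed

lemma Linf_subset_L2: "Linf \<subseteq> L2"
proof
  fix f :: "real ^ 'n \<Rightarrow> complex" assume f: "f \<in> Linf"
  then have meas: "f \<in> borel_measurable cube_measure" by (simp add: Linf_def)
  obtain C where "Linf_norm f \<le> ereal C"
    using f by (cases "Linf_norm f") (auto simp: Linf_def)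
  then show "f \<in> L2" using meas by (auto simp: Linf_norm_le_iff intro: L2_bounded)
qed

lemma finite_dim_subspace_Linf_sum:
  assumes W: "finite_dim_subspace_Linf W" and f: "\<And>i. i \<in> I \<Longrightarrow> f i \<in> W"
  shows "(\<lambda>x. \<Sum>i\<in>I. f i x) \<in> W"
  using f
proof (induction I rule: infinite_finite_induct)
  case (insert i I)
  then show ?case using W by (simp add: finite_dim_subspace_Linf_def)
qed (use W in \<open>auto simp: finite_dim_subspace_Linf_def\<close>)

lemma finite_dim_subspace_Linf_scale:
  "finite_dim_subspace_Linf W \<Longrightarrow> f \<in> W \<Longrightarrow> (\<lambda>x. a * f x) \<in> W"
  by (simp add: finite_dim_subspace_Linf_def)

lemma finite_dim_subspace_Linf_add:
  "finite_dim_subspace_Linf W \<Longrightarrow> f \<in> W \<Longrightarrow> g \<in> W \<Longrightarrow> (\<lambda>x. f x + g x) \<in> W"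
  by (simp add: finite_dim_subspace_Linf_def)

lemma finite_dim_subspace_Linf_diff:
  assumes W: "finite_dim_subspace_Linf W" and "f \<in> W" "g \<in> W"
  shows "(\<lambda>x. f x - g x) \<in> W"
  using finite_dim_subspace_Linf_add[OF W \<open>f \<in> W\<close> finite_dim_subspace_Linf_scale[OF W \<open>g \<in> W\<close>, of "- 1"]]
  by simp

lemma finite_dim_subspace_Linf_L2: "finite_dim_subspace_Linf W \<Longrightarrow> f \<in> W \<Longrightarrow> f \<in> L2"
  using Linf_subset_L2 by (auto simp: finite_dim_subspace_Linf_def)

text \<open>
  Gram--Schmidt up to null sets: a vector whose component orthogonal to the previous ones vanishes
  almost everywhere is dropped. Expansions are asserted only almost everywhere, because elements of
  \<open>W\<close> are representatives of classes.
\<close>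

lemma Gram_Schmidt:
  assumes W: "finite_dim_subspace_Linf W" and B: "finite B" "B \<subseteq> W"
  shows "\<exists>E. finite E \<and> E \<subseteq> W \<and> (\<forall>e\<in>E. \<forall>e'\<in>E. L2_inner e e' = (if e = e' then 1 else 0)) \<and>
    (\<forall>b\<in>B. \<exists>c. AE x in cube_measure. b x = (\<Sum>e\<in>E. c e * e x))"
  using B
proof (induction B rule: finite_induct)
  case empty
  show ?case by (rule exI[of _ "{}"]) simp
next
  case (insert b B)
  from insert.prems have b: "b \<in> W" and "B \<subseteq> W" by simp_all
  from insert.IH[OF \<open>B \<subseteq> W\<close>] obtain E where E: "finite E" "E \<subseteq> W"
    and orth: "\<forall>e\<in>E. \<forall>e'\<in>E. L2_inner e e' = (if e = e' then 1 else 0)"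
    and span: "\<forall>b\<in>B. \<exists>c. AE x in cube_measure. b x = (\<Sum>e\<in>E. c e * e x)"
    by (elim exE conjE) (rule that)
  \<comment> \<open>the part of the new vector orthogonal to the previous basis; if it is null, no vector is added\<close>
  define g where "g = (\<lambda>x. b x - (\<Sum>e\<in>E. L2_inner b e * e x))"
  have g: "g \<in> W"
    unfolding g_def using E b
    by (intro finite_dim_subspace_Linf_diff[OF W] finite_dim_subspace_Linf_sum[OF W]
        finite_dim_subspace_Linf_scale[OF W]) auto
  note L2 = finite_dim_subspace_Linf_L2[OF W]
  have E_L2: "\<And>e. e \<in> E \<Longrightarrow> e \<in> L2" using E L2 by auto
  have g_orth: "L2_inner g e = 0" if e: "e \<in> E" for e
  proof -
    have "L2_inner (\<lambda>x. \<Sum>e\<in>E. L2_inner b e * e x) e = (\<Sum>e'\<in>E. L2_inner b e' * L2_inner e' e)"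
      using e by (simp add: L2_inner_sum_left L2_inner_scale_left L2_scale E_L2)
    also have "\<dots> = (\<Sum>e'\<in>E. if e' = e then L2_inner b e' else 0)"
      using e by (intro sum.cong) (auto simp: orth)
    finally show ?thesis
      using e E by (simp add: g_def L2_inner_diff_left L2 b L2_sum L2_scale E_L2)
  qed
  show ?case
  proof (cases "L2_norm g = 0")
    case True
    then have "AE x in cube_measure. g x = 0" using g L2 by (simp add: L2_norm_eq_0_iff)
    then have "AE x in cube_measure. b x = (\<Sum>e\<in>E. L2_inner b e * e x)"
      by eventually_elim (simp add: g_def)
    then have "\<exists>c. AE x in cube_measure. b x = (\<Sum>e\<in>E. c e * e x)"
      by (rule exI[where x = "L2_inner b"])
    with span have "\<forall>a\<in>insert b B. \<exists>c. AE x in cube_measure. a x = (\<Sum>e\<in>E. c e * e x)"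
      by blast
    then show ?thesis using E orth by (intro exI[of _ E] conjI)
  next
    case False
    define u where "u = (\<lambda>x. complex_of_real (1 / L2_norm g) * g x)"
    have u: "u \<in> W" unfolding u_def by (intro finite_dim_subspace_Linf_scale[OF W] g)
    have u_orth: "L2_inner u e = 0" "L2_inner e u = 0" if "e \<in> E" for e
    proof -
      show "L2_inner u e = 0" using g_orth[OF that] by (simp only: u_def L2_inner_scale_left) simp
      then show "L2_inner e u = 0" using L2_inner_cnj[of u e] by simp
    qed
    have "L2_norm u = 1" using False by (simp only: u_def L2_norm_scale) (simp add: norm_divide)
    then have u_unit: "L2_inner u u = 1" by (simp add: L2_inner_self)
    have "u \<notin> E" using u_unit u_orth by force
    have expansion: "\<exists>c. AE x in cube_measure. a x = (\<Sum>e\<in>insert u E. c e * e x)" if "a \<in> insert b B" for a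
    proof (cases "a = b")
      case True
      have "b x = (\<Sum>e\<in>insert u E. ((L2_inner b)(u := of_real (L2_norm g))) e * e x)" for x
      proof -
        have "(\<Sum>e\<in>E. ((L2_inner b)(u := of_real (L2_norm g))) e * e x) = (\<Sum>e\<in>E. L2_inner b e * e x)"
          using \<open>u \<notin> E\<close> by (intro sum.cong) auto
        moreover have "of_real (L2_norm g) * u x = g x" using False by (simp add: u_def)
        ultimately show ?thesis using E \<open>u \<notin> E\<close> by (simp add: g_def)
      qed
      then have "AE x in cube_measure. b x = (\<Sum>e\<in>insert u E. ((L2_inner b)(u := of_real (L2_norm g))) e * e x)"
        by (rule AE_I2)
      then show ?thesis unfolding \<open>a = b\<close>
        by (rule exI[where x = "(L2_inner b)(u := of_real (L2_norm g))"])
    next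
      case False
      then have "a \<in> B" using that by simp
      from bspec[OF span this] obtain c where c: "AE x in cube_measure. a x = (\<Sum>e\<in>E. c e * e x)"
        by (elim exE) (rule that)
      have upd: "(\<Sum>e\<in>insert u E. (c(u := 0)) e * e x) = (\<Sum>e\<in>E. c e * e x)" for x
      proof -
        have "(\<Sum>e\<in>E. (c(u := 0)) e * e x) = (\<Sum>e\<in>E. c e * e x)"
          using \<open>u \<notin> E\<close> by (intro sum.cong) auto
        then show ?thesis using E \<open>u \<notin> E\<close> by simp
      qed
      have "AE x in cube_measure. a x = (\<Sum>e\<in>insert u E. (c(u := 0)) e * e x)"
        unfolding upd by (rule c)
      then show ?thesis by (rule exI[where x = "c(u := 0)"])
    qed
    have orthonormal: "L2_inner e e' = (if e = e' then 1 else 0)" if "e \<in> insert u E" "e' \<in> insert u E" for e e'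
    proof (cases "e = u"; cases "e' = u")
      assume "e = u" "e' = u"
      then show ?thesis using u_unit by simp
    next
      assume "e = u" "e' \<noteq> u"
      then show ?thesis using u_orth(1)[of e'] that by simp
    next
      assume "e \<noteq> u" "e' = u"
      then show ?thesis using u_orth(2)[of e] that by simp
    next
      assume "e \<noteq> u" "e' \<noteq> u"
      then show ?thesis using orth that by blast
    qed
    show ?thesis
    proof (rule exI[of _ "insert u E"], intro conjI ballI)
      show "finite (insert u E)" "insert u E \<subseteq> W" using E u by simp_all
    qed (rule orthonormal expansion; assumption)+
  qed
qed

lemma finite_dim_subspace_Linf_orthonormal_basis:
  assumes W: "finite_dim_subspace_Linf W"
  obtains E where "finite E" "E \<subseteq> W"
    and "\<And>f. f \<in> W \<Longrightarrow> AE x in cube_measure. f x = (\<Sum>e\<in>E. L2_inner f e * e x)"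
    and "\<And>e. e \<in> E \<Longrightarrow> L2_norm e = 1"
proof -
  obtain B where B: "finite B" "B \<subseteq> W"
    and span: "\<And>f. f \<in> W \<Longrightarrow> \<exists>a :: (real ^ 'a \<Rightarrow> complex) \<Rightarrow> complex.
           AE x in cube_measure. f x = (\<Sum>b\<in>B. a b * b x)"
    using W unfolding finite_dim_subspace_Linf_def by blast
  obtain E where E: "finite E" "E \<subseteq> W"
    and orth: "\<forall>e\<in>E. \<forall>e'\<in>E. L2_inner e e' = (if e = e' then 1 else 0)"
    and B_span: "\<forall>b\<in>B. \<exists>c. AE x in cube_measure. b x = (\<Sum>e\<in>E. c e * e x)"
    using Gram_Schmidt[OF W B] by (elim exE conjE) (rule that)
  obtain c where c: "\<forall>b\<in>B. AE x in cube_measure. b x = (\<Sum>e\<in>E. c b e * e x)"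
    using bchoice[OF B_span] by (elim exE) (rule that)
  note L2 = finite_dim_subspace_Linf_L2[OF W]
  have E_L2: "\<And>e. e \<in> E \<Longrightarrow> e \<in> L2" using E L2 by auto
  show thesis
  proof (rule that[OF E])
    fix e assume "e \<in> E"
    then have "L2_inner e e = 1" using orth by simp
    then have "complex_of_real ((L2_norm e)\<^sup>2) = 1" by (simp only: L2_inner_self)
    then have "(L2_norm e)\<^sup>2 = 1" by (simp only: of_real_eq_1_iff)
    then show "L2_norm e = 1" using L2_norm_nonneg[of e] by (simp add: power2_eq_1_iff)
  next
    fix f assume f: "f \<in> W"
    then obtain a where a: "AE x in cube_measure. f x = (\<Sum>b\<in>B. a b * b x)"
      using span by blast
    define d where "d = (\<lambda>e. \<Sum>b\<in>B. a b * c b e)"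
    have "AE x in cube_measure. \<forall>b\<in>B. b x = (\<Sum>e\<in>E. c b e * e x)"
      using c B by (simp add: AE_finite_all)
    with a have fd: "AE x in cube_measure. f x = (\<Sum>e\<in>E. d e * e x)"
    proof eventually_elim
      case (elim x)
      have "f x = (\<Sum>b\<in>B. a b * (\<Sum>e\<in>E. c b e * e x))"
        unfolding elim(1)
        by (intro sum.cong refl arg_cong2[where f = "(*)"]) (rule bspec[OF elim(2)])
      also have "\<dots> = (\<Sum>b\<in>B. \<Sum>e\<in>E. a b * c b e * e x)"
        by (simp add: sum_distrib_left mult.assoc)
      also have "\<dots> = (\<Sum>e\<in>E. \<Sum>b\<in>B. a b * c b e * e x)" by (rule sum.swap)
      finally show ?case by (simp add: d_def sum_distrib_right)
    qed
    have "L2_inner f e = d e" if e: "e \<in> E" for e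
    proof -
      have "L2_inner f e = L2_inner (\<lambda>x. \<Sum>e\<in>E. d e * e x) e"
        using e by (intro L2_inner_cong_AE fd L2_measurable L2_sum L2_scale L2 f E_L2)
      also have "\<dots> = (\<Sum>e'\<in>E. d e' * L2_inner e' e)"
        using e by (simp add: L2_inner_sum_left L2_inner_scale_left L2_scale E_L2)
      also have "\<dots> = (\<Sum>e'\<in>E. if e' = e then d e' else 0)"
        using e by (intro sum.cong) (auto simp: orth)
      finally show ?thesis using e E by simp
    qed
    then show "AE x in cube_measure. f x = (\<Sum>e\<in>E. L2_inner f e * e x)"
      using fd by (simp cong: sum.cong)
  qed
qed

lemma Linf_ball_AE_le:
  assumes "W \<subseteq> Linf" "f \<in> Linf_ball W R"
  shows "AE x in cube_measure. cmod (f x) \<le> R"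
proof -
  have "f \<in> Linf" using assms by (auto simp: Linf_ball_def)
  then show ?thesis using assms(2) by (simp add: Linf_def Linf_ball_def Linf_norm_le_iff)
qed

lemma Linf_ballI:
  assumes W: "finite_dim_subspace_Linf W" and "f \<in> W" "AE x in cube_measure. cmod (f x) \<le> R"
  shows "f \<in> Linf_ball W R"
  using assms(2,3) L2_measurable[OF finite_dim_subspace_Linf_L2[OF W assms(2)]]
  by (simp add: Linf_ball_def Linf_norm_le_iff)

lemma Linf_ball_convex:
  assumes W: "finite_dim_subspace_Linf W"
    and fg: "f \<in> Linf_ball W R" "g \<in> Linf_ball W R" and t: "0 \<le> t" "t \<le> 1"
  shows "(\<lambda>x. complex_of_real (1 - t) * f x + complex_of_real t * g x) \<in> Linf_ball W R"
proof (rule Linf_ballI[OF W])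
  have sub: "W \<subseteq> Linf" using W by (simp add: finite_dim_subspace_Linf_def)
  have "f \<in> W" "g \<in> W" using fg by (auto simp: Linf_ball_def)
  then show "(\<lambda>x. complex_of_real (1 - t) * f x + complex_of_real t * g x) \<in> W"
    by (intro finite_dim_subspace_Linf_add[OF W] finite_dim_subspace_Linf_scale[OF W])
  show "AE x in cube_measure. cmod (complex_of_real (1 - t) * f x + complex_of_real t * g x) \<le> R"
    using Linf_ball_AE_le[OF sub fg(1)] Linf_ball_AE_le[OF sub fg(2)]
  proof eventually_elim
    case (elim x)
    have "cmod (complex_of_real (1 - t) * f x + complex_of_real t * g x)
        \<le> (1 - t) * cmod (f x) + t * cmod (g x)"
      by (rule order_trans[OF norm_triangle_ineq]) (use t in \<open>simp add: norm_mult del: of_real_diff\<close>)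
    also have "\<dots> \<le> (1 - t) * R + t * R"
      using elim t by (intro add_mono mult_left_mono) auto
    finally show ?case by (simp add: algebra_simps)
  qed
qed

text \<open>
  Cauchy sequences in $L^2$ have Cauchy coordinates in an orthonormal basis. The function with the
  limiting coordinates is also an almost everywhere pointwise limit, which is why it inherits the
  essential bound.
\<close>

lemma Linf_ball_complete:
  assumes W: "finite_dim_subspace_Linf W" and g: "\<And>m. g m \<in> Linf_ball W R"
    and Cauchy: "\<And>e. e > 0 \<Longrightarrow> \<exists>M. \<forall>m\<ge>M. \<forall>n\<ge>M. L2_norm (\<lambda>x. g m x - g n x) < e"
  shows "\<exists>h\<in>Linf_ball W R. (\<lambda>m. L2_norm (\<lambda>x. g m x - h x)) \<longlonglongrightarrow> 0"
proof -
  note L2 = finite_dim_subspace_Linf_L2[OF W]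
  have sub: "W \<subseteq> Linf" using W by (simp add: finite_dim_subspace_Linf_def)
  obtain E where E: "finite E" "E \<subseteq> W"
    and expand: "\<And>f. f \<in> W \<Longrightarrow> AE x in cube_measure. f x = (\<Sum>e\<in>E. L2_inner f e * e x)"
    and unit: "\<And>e. e \<in> E \<Longrightarrow> L2_norm e = 1"
    by (rule finite_dim_subspace_Linf_orthonormal_basis[OF W]) (rule that)
  have gW: "g m \<in> W" for m using g by (auto simp: Linf_ball_def)
  have E_L2: "\<And>e. e \<in> E \<Longrightarrow> e \<in> L2" using E L2 by auto
  have "\<exists>l. (\<lambda>m. L2_inner (g m) e) \<longlonglongrightarrow> l" if e: "e \<in> E" for e
  proof -
    have "Cauchy (\<lambda>m. L2_inner (g m) e)"
    proof (rule metric_CauchyI)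
      fix d :: real assume "d > 0"
      then obtain M where M: "\<And>m n. m \<ge> M \<Longrightarrow> n \<ge> M \<Longrightarrow> L2_norm (\<lambda>x. g m x - g n x) < d"
        using Cauchy by blast
      have "dist (L2_inner (g m) e) (L2_inner (g n) e) < d" if "m \<ge> M" "n \<ge> M" for m n
      proof -
        have "dist (L2_inner (g m) e) (L2_inner (g n) e) = cmod (L2_inner (\<lambda>x. g m x - g n x) e)"
          using e by (simp add: dist_norm L2_inner_diff_left L2 gW E_L2)
        also have "\<dots> \<le> L2_norm (\<lambda>x. g m x - g n x) * L2_norm e"
          using e by (intro L2_Cauchy_Schwarz L2_diff L2 gW E_L2)
        finally show ?thesis using M[OF that] unit[OF e] by simp
      qed
      then show "\<exists>M. \<forall>m\<ge>M. \<forall>n\<ge>M. dist (L2_inner (g m) e) (L2_inner (g n) e) < d" by blast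
    qed
    then show ?thesis using Cauchy_convergent convergent_def by blast
  qed
  then have "\<forall>e\<in>E. \<exists>l. (\<lambda>m. L2_inner (g m) e) \<longlonglongrightarrow> l" ..
  from bchoice[OF this] obtain l where l: "\<And>e. e \<in> E \<Longrightarrow> (\<lambda>m. L2_inner (g m) e) \<longlonglongrightarrow> l e"
    by (elim exE) (rule that, erule (1) bspec)
  define h where "h = (\<lambda>x. \<Sum>e\<in>E. l e * e x)"
  have hW: "h \<in> W"
    unfolding h_def using E
    by (intro finite_dim_subspace_Linf_sum[OF W] finite_dim_subspace_Linf_scale[OF W]) auto
  have "AE x in cube_measure. \<forall>m. g m x = (\<Sum>e\<in>E. L2_inner (g m) e * e x) \<and> cmod (g m x) \<le> R"
    unfolding AE_all_countable AE_conj_iff by (intro allI conjI expand gW Linf_ball_AE_le[OF sub g])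
  then have "AE x in cube_measure. cmod (h x) \<le> R"
  proof eventually_elim
    case (elim x)
    have "(\<lambda>m. cmod (\<Sum>e\<in>E. L2_inner (g m) e * e x)) \<longlonglongrightarrow> cmod (h x)"
      unfolding h_def by (intro tendsto_intros l)
    moreover have "\<forall>m. cmod (\<Sum>e\<in>E. L2_inner (g m) e * e x) \<le> R"
    proof
      fix m
      have "g m x = (\<Sum>e\<in>E. L2_inner (g m) e * e x)" "cmod (g m x) \<le> R"
        using spec[OF elim, of m] by (rule conjunct1, rule conjunct2)
      then show "cmod (\<Sum>e\<in>E. L2_inner (g m) e * e x) \<le> R" by (rule subst)
    qed
    ultimately show ?case by (intro LIMSEQ_le_const2[of _ "cmod (h x)" R]) auto
  qed
  then have "h \<in> Linf_ball W R" by (rule Linf_ballI[OF W hW])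
  moreover have "(\<lambda>m. L2_norm (\<lambda>x. g m x - h x)) \<longlonglongrightarrow> 0"
  proof (rule tendsto_sandwich[OF _ _ tendsto_const])
    have "(\<lambda>m. \<Sum>e\<in>E. cmod (L2_inner (g m) e - l e)) \<longlonglongrightarrow> (\<Sum>e\<in>E. cmod (l e - l e))"
      by (intro tendsto_intros l)
    then show "(\<lambda>m. \<Sum>e\<in>E. cmod (L2_inner (g m) e - l e)) \<longlonglongrightarrow> 0" by simp
    have "L2_norm (\<lambda>x. g m x - h x) \<le> (\<Sum>e\<in>E. cmod (L2_inner (g m) e - l e))" for m
    proof -
      have "AE x in cube_measure. g m x - h x = (\<Sum>e\<in>E. (L2_inner (g m) e - l e) * e x)"
        using expand[OF gW[of m]]
        by eventually_elim (simp add: h_def left_diff_distrib sum_subtractf)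
      then have "L2_norm (\<lambda>x. g m x - h x) = L2_norm (\<lambda>x. \<Sum>e\<in>E. (L2_inner (g m) e - l e) * e x)"
        by (intro L2_norm_cong_AE L2_measurable L2_diff L2_sum L2_scale L2 gW hW E_L2)
      also have "\<dots> \<le> (\<Sum>e\<in>E. L2_norm (\<lambda>x. (L2_inner (g m) e - l e) * e x))"
        by (intro L2_norm_sum_le L2_scale E_L2)
      also have "\<dots> = (\<Sum>e\<in>E. cmod (L2_inner (g m) e - l e))"
        by (simp add: L2_norm_scale unit)
      finally show ?thesis .
    qed
    then show "\<forall>\<^sub>F m in sequentially. L2_norm (\<lambda>x. g m x - h x) \<le> (\<Sum>e\<in>E. cmod (L2_inner (g m) e - l e))"
      by simp
  qed simp
  ultimately show ?thesis by blast
qed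

text \<open>
  Existence of a minimiser, so that the choice operator in \<open>nearest_point\<close> picks one. For two
  elements of a minimising sequence the midpoint lies in the ball, and the parallelogram law bounds
  their distance by the amounts by which they fail to be optimal.
\<close>

lemma nearest_point_Linf_ball:
  assumes W: "finite_dim_subspace_Linf W" and q: "q \<in> Linf_ball W R" and f: "f \<in> L2"
  shows nearest_point_in_Linf_ball: "nearest_point (Linf_ball W R) f \<in> Linf_ball W R"
    and nearest_point_le: "h \<in> Linf_ball W R \<Longrightarrow>
      L2_norm (\<lambda>x. f x - nearest_point (Linf_ball W R) f x) \<le> L2_norm (\<lambda>x. f x - h x)"
proof -
  define S where "S = Linf_ball W R"
  note L2 = finite_dim_subspace_Linf_L2[OF W]
  have SL2: "h \<in> L2" if "h \<in> S" for h using that L2 by (auto simp: S_def Linf_ball_def)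
  define d where "d = (INF h\<in>S. L2_norm (\<lambda>x. f x - h x))"
  have bdd: "bdd_below ((\<lambda>h. L2_norm (\<lambda>x. f x - h x)) ` S)" by (rule bdd_belowI2[of _ 0]) simp
  have d_le: "d \<le> L2_norm (\<lambda>x. f x - h x)" if "h \<in> S" for h
    unfolding d_def using bdd that by (rule cINF_lower)
  have d0: "d \<ge> 0" unfolding d_def using q by (intro cINF_greatest) (auto simp: S_def)
  have "\<exists>h\<in>S. L2_norm (\<lambda>x. f x - h x) < sqrt (d\<^sup>2 + 1 / real (Suc m))" for m
  proof -
    have "sqrt (d\<^sup>2) < sqrt (d\<^sup>2 + 1 / real (Suc m))" by (intro real_sqrt_less_mono) simp
    then have "d < sqrt (d\<^sup>2 + 1 / real (Suc m))" using d0 by simp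
    then show ?thesis
      using q bdd unfolding d_def by (subst (asm) cINF_less_iff) (auto simp: S_def)
  qed
  then have "\<forall>m. \<exists>h. h \<in> S \<and> L2_norm (\<lambda>x. f x - h x) < sqrt (d\<^sup>2 + 1 / real (Suc m))"
    by blast
  from choice[OF this] obtain g
    where "\<forall>m. g m \<in> S \<and> L2_norm (\<lambda>x. f x - g m x) < sqrt (d\<^sup>2 + 1 / real (Suc m))"
    by (elim exE) (rule that)
  then have gS: "\<And>m. g m \<in> S"
    and g: "\<And>m. L2_norm (\<lambda>x. f x - g m x) < sqrt (d\<^sup>2 + 1 / real (Suc m))"
    by simp_all
  have g_sq: "(L2_norm (\<lambda>x. f x - g m x))\<^sup>2 \<le> d\<^sup>2 + 1 / real (Suc m)" for m
  proof -
    have "(L2_norm (\<lambda>x. f x - g m x))\<^sup>2 \<le> (sqrt (d\<^sup>2 + 1 / real (Suc m)))\<^sup>2"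
      by (intro power_mono less_imp_le[OF g]) simp
    also have "\<dots> = d\<^sup>2 + 1 / real (Suc m)" by (rule real_sqrt_pow2) simp
    finally show ?thesis .
  qed
  \<comment> \<open>parallelogram law, with the midpoint as a competitor\<close>
  have gap: "(L2_norm (\<lambda>x. g m x - g n x))\<^sup>2 \<le> 2 / real (Suc m) + 2 / real (Suc n)" for m n
  proof -
    let ?a = "\<lambda>x. f x - g m x" and ?b = "\<lambda>x. f x - g n x"
    let ?mid = "\<lambda>x. complex_of_real (1 - 1 / 2) * g m x + complex_of_real (1 / 2) * g n x"
    have ab: "?a \<in> L2" "?b \<in> L2" by (intro L2_diff f SL2 gS)+
    have "?mid \<in> S" unfolding S_def using gS by (intro Linf_ball_convex[OF W]) (auto simp: S_def)
    then have "2 * d \<le> 2 * L2_norm (\<lambda>x. f x - ?mid x)" using d_le by simp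
    also have "\<dots> = L2_norm (\<lambda>x. 2 * (f x - ?mid x))" by (subst L2_norm_scale) simp
    also have "(\<lambda>x. 2 * (f x - ?mid x)) = (\<lambda>x. ?a x + ?b x)" by (simp add: algebra_simps)
    finally have "(2 * d)\<^sup>2 \<le> (L2_norm (\<lambda>x. ?a x + ?b x))\<^sup>2" using d0 by (intro power_mono) auto
    then have "4 * d\<^sup>2 \<le> (L2_norm (\<lambda>x. ?a x + ?b x))\<^sup>2" by (simp add: power_mult_distrib)
    moreover have "(L2_norm (\<lambda>x. g m x - g n x))\<^sup>2 = (L2_norm (\<lambda>x. ?a x - ?b x))\<^sup>2"
    proof -
      have "(\<lambda>x. ?a x - ?b x) = (\<lambda>x. g n x - g m x)" by (simp add: fun_eq_iff)
      then show ?thesis by (simp only: L2_norm_minus_commute[of "g m" "g n"])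
    qed
    ultimately show ?thesis
      using L2_norm_add_square[OF ab] L2_norm_diff_square[OF ab] g_sq[of m] g_sq[of n]
      by linarith
  qed
  have "\<exists>h\<in>S. (\<lambda>m. L2_norm (\<lambda>x. g m x - h x)) \<longlonglongrightarrow> 0"
    unfolding S_def
  proof (rule Linf_ball_complete[OF W])
    show "g m \<in> Linf_ball W R" for m using gS by (simp add: S_def)
    fix e :: real assume "e > 0"
    obtain M where "4 / e\<^sup>2 < real M" using reals_Archimedean2 by blast
    then have "4 / e\<^sup>2 < real (Suc M)" by simp
    then have M: "4 / real (Suc M) < e\<^sup>2"
      using \<open>e > 0\<close> by (simp add: divide_less_eq mult.commute)
    have "L2_norm (\<lambda>x. g m x - g n x) < e" if "m \<ge> M" "n \<ge> M" for m n
    proof (rule power2_less_imp_less)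
      have "2 / real (Suc m) \<le> 2 / real (Suc M)" "2 / real (Suc n) \<le> 2 / real (Suc M)"
        using that by (intro divide_left_mono; simp)+
      then show "(L2_norm (\<lambda>x. g m x - g n x))\<^sup>2 < e\<^sup>2" using gap[of m n] M by simp
    qed (use \<open>e > 0\<close> in simp)
    then show "\<exists>M. \<forall>m\<ge>M. \<forall>n\<ge>M. L2_norm (\<lambda>x. g m x - g n x) < e" by blast
  qed
  then obtain h where h: "h \<in> S" and lim: "(\<lambda>m. L2_norm (\<lambda>x. g m x - h x)) \<longlonglongrightarrow> 0" by blast
  have "L2_norm (\<lambda>x. f x - h x) \<le> d"
  proof (rule LIMSEQ_le_const)
    have "(\<lambda>m. sqrt (d\<^sup>2 + 1 / real (Suc m)) + L2_norm (\<lambda>x. g m x - h x)) \<longlonglongrightarrow> sqrt (d\<^sup>2 + 0) + 0"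
      by (intro tendsto_intros lim LIMSEQ_Suc[OF lim_1_over_n])
    then show "(\<lambda>m. sqrt (d\<^sup>2 + 1 / real (Suc m)) + L2_norm (\<lambda>x. g m x - h x)) \<longlonglongrightarrow> d"
      using d0 by simp
    have "L2_norm (\<lambda>x. f x - h x) \<le> sqrt (d\<^sup>2 + 1 / real (Suc m)) + L2_norm (\<lambda>x. g m x - h x)" for m
      using L2_norm_triangle_diff[OF f SL2[OF gS] SL2[OF h], of m] g[of m] by linarith
    then show "\<exists>M. \<forall>m\<ge>M. L2_norm (\<lambda>x. f x - h x) \<le> sqrt (d\<^sup>2 + 1 / real (Suc m)) + L2_norm (\<lambda>x. g m x - h x)"
      by blast
  qed
  then have "h \<in> S \<and> (\<forall>h'\<in>S. L2_norm (\<lambda>x. f x - h x) \<le> L2_norm (\<lambda>x. f x - h' x))"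
    using h by (intro conjI ballI order_trans[OF _ d_le])
  then have *: "nearest_point S f \<in> S \<and>
      (\<forall>h'\<in>S. L2_norm (\<lambda>x. f x - nearest_point S f x) \<le> L2_norm (\<lambda>x. f x - h' x))"
    unfolding nearest_point_def
    by (rule someI[where P = "\<lambda>g. g \<in> S \<and> (\<forall>h\<in>S. L2_norm (\<lambda>x. f x - g x) \<le> L2_norm (\<lambda>x. f x - h x))"])
  then show "nearest_point (Linf_ball W R) f \<in> Linf_ball W R" by (simp add: S_def)
  show "L2_norm (\<lambda>x. f x - nearest_point (Linf_ball W R) f x) \<le> L2_norm (\<lambda>x. f x - h x)"
    if "h \<in> Linf_ball W R" for h
    using * that by (simp add: S_def)
qed

text \<open>
  With $g$ the nearest point to $f$, minimality along the segment from $g$ to $q$ yields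
  $\mathrm{Re}\langle f-g,q-g\rangle\le0$: the angle at $g$ is at least a right angle, so the side
  opposite to it is at least as long as the side from $q$ to $g$.
\<close>

lemma nearest_point_closer:
  assumes W: "finite_dim_subspace_Linf W" and q: "q \<in> Linf_ball W R" and f: "f \<in> L2"
  shows "L2_norm (\<lambda>x. q x - nearest_point (Linf_ball W R) f x) \<le> L2_norm (\<lambda>x. q x - f x)"
proof -
  define g where "g = nearest_point (Linf_ball W R) f"
  have g: "g \<in> Linf_ball W R"
    unfolding g_def by (rule nearest_point_in_Linf_ball[OF W q f])
  have L2: "q \<in> L2" "g \<in> L2"
    using q g finite_dim_subspace_Linf_L2[OF W] by (auto simp: Linf_ball_def)
  let ?u = "\<lambda>x. f x - g x" and ?v = "\<lambda>x. q x - g x"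
  have uv: "?u \<in> L2" "?v \<in> L2" using L2 f by (auto intro: L2_diff)
  define r where "r = Re (L2_inner ?u ?v)"
  have small: "2 * r \<le> t * (L2_norm ?v)\<^sup>2" if t: "0 < t" "t \<le> 1" for t
  proof -
    have "(\<lambda>x. f x - (complex_of_real (1 - t) * g x + complex_of_real t * q x))
        = (\<lambda>x. ?u x - complex_of_real t * ?v x)"
      by (simp add: algebra_simps)
    moreover have "L2_norm ?u \<le> L2_norm (\<lambda>x. f x - (complex_of_real (1 - t) * g x + complex_of_real t * q x))"
      unfolding g_def using t g
      by (intro nearest_point_le[OF W q f] Linf_ball_convex[OF W] q) (auto simp: g_def)
    ultimately have "(L2_norm ?u)\<^sup>2 \<le> (L2_norm (\<lambda>x. ?u x - complex_of_real t * ?v x))\<^sup>2"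
      by (intro power_mono) auto
    also have "\<dots> = (L2_norm ?u)\<^sup>2 + t\<^sup>2 * (L2_norm ?v)\<^sup>2 - 2 * (t * r)"
      using t by (simp only: L2_norm_diff_square[OF uv(1) L2_scale[OF uv(2)]] L2_norm_scale
          L2_inner_scale_right r_def) (simp add: power_mult_distrib)
    finally have "t * (2 * r) \<le> t * (t * (L2_norm ?v)\<^sup>2)" by (simp add: power2_eq_square mult_ac)
    then show ?thesis using t by simp
  qed
  have "r \<le> 0"
  proof (rule ccontr)
    assume "\<not> r \<le> 0"
    define n where "n = (L2_norm ?v)\<^sup>2"
    have n: "n \<ge> 0" by (simp add: n_def)
    \<comment> \<open>small enough that the quadratic term cannot compensate the linear gain\<close>
    define t where "t = min 1 (r / (n + 1))"
    have t: "0 < t" "t \<le> 1" using \<open>\<not> r \<le> 0\<close> n by (auto simp: t_def)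
    have "t * n \<le> r / (n + 1) * (n + 1)"
      using n \<open>\<not> r \<le> 0\<close> t by (intro mult_mono) (auto simp: t_def)
    also have "\<dots> = r" using n by simp
    finally show False using small[OF t] \<open>\<not> r \<le> 0\<close> by (simp add: n_def)
  qed
  moreover have "(L2_norm (\<lambda>x. ?v x - ?u x))\<^sup>2 = (L2_norm ?v)\<^sup>2 + (L2_norm ?u)\<^sup>2 - 2 * r"
  proof -
    have "Re (L2_inner ?v ?u) = r"
      unfolding r_def L2_inner_cnj[of ?u ?v, symmetric] by simp
    then show ?thesis using L2_norm_diff_square[OF uv(2,1)] by linarith
  qed
  ultimately have "(L2_norm ?v)\<^sup>2 \<le> (L2_norm (\<lambda>x. ?v x - ?u x))\<^sup>2"
    using zero_le_power2[of "L2_norm ?u"] by linarith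
  then have "L2_norm ?v \<le> L2_norm (\<lambda>x. ?v x - ?u x)" by (rule power2_le_imp_le) simp
  then show ?thesis by (simp add: g_def)
qed

text \<open>
  On \<open>W\<close> itself the function is its own projection, and two admissible choices differ by an element
  of \<open>W\<close> that is orthogonal to itself.
\<close>

lemma orth_proj_AE:
  assumes W: "finite_dim_subspace_Linf W" and f: "f \<in> W"
  shows "orth_proj W f \<in> W" "AE x in cube_measure. orth_proj W f x = f x"
proof -
  have "f \<in> W \<and> (\<forall>w\<in>W. L2_inner (\<lambda>x. f x - f x) w = 0)"
    using f by (simp add: L2_inner_def)
  then have *: "orth_proj W f \<in> W \<and> (\<forall>w\<in>W. L2_inner (\<lambda>x. f x - orth_proj W f x) w = 0)"
    unfolding orth_proj_def
    by (rule someI[where P = "\<lambda>g. g \<in> W \<and> (\<forall>w\<in>W. L2_inner (\<lambda>x. f x - g x) w = 0)"])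
  then show "orth_proj W f \<in> W" by simp
  let ?d = "\<lambda>x. f x - orth_proj W f x"
  have d: "?d \<in> W" using * f by (intro finite_dim_subspace_Linf_diff[OF W]) auto
  then have "L2_inner ?d ?d = 0" using * by blast
  then have "L2_norm ?d = 0" by (simp add: L2_inner_self)
  then have "AE x in cube_measure. ?d x = 0"
    using finite_dim_subspace_Linf_L2[OF W d] by (simp add: L2_norm_eq_0_iff)
  then show "AE x in cube_measure. orth_proj W f x = f x" by eventually_elim simp
qed

section \<open>Inverting the discrete Fourier transform\<close>

text \<open>
  The choice operator in \<open>fourier_inv\<close> yields the right coefficients as soon as some function has
  them.
\<close>

lemma fourier_inv_eqI:
  assumes "f \<in> L2" "\<And>l. l \<ge> 1 \<Longrightarrow> fourier \<rho> f l = a l"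
  shows fourier_inv_L2: "fourier_inv \<rho> a \<in> L2"
    and fourier_fourier_inv: "l \<ge> 1 \<Longrightarrow> fourier \<rho> (fourier_inv \<rho> a) l = a l"
proof -
  have "f \<in> L2 \<and> (\<forall>l\<ge>1. fourier \<rho> f l = a l)" using assms by simp
  then have "fourier_inv \<rho> a \<in> L2 \<and> (\<forall>l\<ge>1. fourier \<rho> (fourier_inv \<rho> a) l = a l)"
    unfolding fourier_inv_def
    by (rule someI[where P = "\<lambda>f. f \<in> L2 \<and> (\<forall>l\<ge>1. fourier \<rho> f l = a l)"])
  then show "fourier_inv \<rho> a \<in> L2"
    and "l \<ge> 1 \<Longrightarrow> fourier \<rho> (fourier_inv \<rho> a) l = a l" by simp_all
qed

definition trig_sum :: "(nat \<Rightarrow> int ^ 'n) \<Rightarrow> nat \<Rightarrow> (nat \<Rightarrow> complex) \<Rightarrow> real ^ 'n \<Rightarrow> complex" where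
  "trig_sum \<rho> N a x = (\<Sum>j\<in>{1..N}. a j * trig (\<rho> j) x)"

lemma trig_sum_L2: "trig_sum \<rho> N a \<in> L2"
  unfolding trig_sum_def by (intro L2_sum L2_scale trig_L2)

lemma fourier_trig_sum:
  assumes "inj_on \<rho> {1..}" "l \<ge> 1"
  shows "fourier \<rho> (trig_sum \<rho> N a) l = seq_proj N a l"
proof -
  have "fourier \<rho> (trig_sum \<rho> N a) l = (\<Sum>j\<in>{1..N}. a j * L2_inner (trig (\<rho> j)) (trig (\<rho> l)))"
    unfolding fourier_eq_inner trig_sum_def
    by (simp add: L2_inner_sum_left L2_inner_scale_left L2_scale trig_L2)
  also have "\<dots> = (\<Sum>j\<in>{1..N}. if j = l then a j else 0)"
  proof (rule sum.cong[OF refl])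
    fix j assume "j \<in> {1..N}"
    then have "\<rho> j = \<rho> l \<longleftrightarrow> j = l" using assms by (auto simp: inj_on_eq_iff)
    then show "a j * L2_inner (trig (\<rho> j)) (trig (\<rho> l)) = (if j = l then a j else 0)"
      by (simp add: trig_orthonormal)
  qed
  finally show ?thesis by (simp add: seq_proj_def)
qed

lemma fourier_inv_seq_proj:
  assumes "inj_on \<rho> {1..}"
  shows "fourier_inv \<rho> (seq_proj N a) \<in> L2"
    and "l \<ge> 1 \<Longrightarrow> fourier \<rho> (fourier_inv \<rho> (seq_proj N a)) l = seq_proj N a l"
  using fourier_inv_eqI[OF trig_sum_L2 fourier_trig_sum[OF assms]] by blast+

lemma fourier_inv_seq_proj_compl:
  assumes inj: "inj_on \<rho> {1..}" and f: "f \<in> L2"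
  shows "fourier_inv \<rho> (seq_proj_compl N (fourier \<rho> f)) \<in> L2"
    and "l \<ge> 1 \<Longrightarrow>
      fourier \<rho> (fourier_inv \<rho> (seq_proj_compl N (fourier \<rho> f))) l = seq_proj_compl N (fourier \<rho> f) l"
proof -
  let ?T = "trig_sum \<rho> N (fourier \<rho> f)"
  have "fourier \<rho> (\<lambda>x. f x - ?T x) l = seq_proj_compl N (fourier \<rho> f) l" if "l \<ge> 1" for l
    using fourier_trig_sum[OF inj that, of N "fourier \<rho> f"]
    by (simp add: fourier_eq_inner L2_inner_diff_left f trig_sum_L2 trig_L2 seq_proj_compl_def)
  from fourier_inv_eqI[OF L2_diff[OF f trig_sum_L2] this]
  show "fourier_inv \<rho> (seq_proj_compl N (fourier \<rho> f)) \<in> L2"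
    and "l \<ge> 1 \<Longrightarrow>
      fourier \<rho> (fourier_inv \<rho> (seq_proj_compl N (fourier \<rho> f))) l = seq_proj_compl N (fourier \<rho> f) l"
    by blast+
qed

section \<open>Splitting the measurement into a linear part and a remainder\<close>

text \<open>
  The weight is bounded below by a positive constant on the cube.
\<close>

lemma weighted_L2_subset_L2: "weighted_L2 \<subseteq> L2"
proof
  fix r :: "real ^ 'n \<Rightarrow> complex" assume r: "r \<in> weighted_L2"
  define w where "w = (\<lambda>x :: real ^ 'n. complex_of_real ((1 + (norm x)\<^sup>2) powr (- 1 / 4)))"
  have meas: "r \<in> borel_measurable cube_measure"
    using r by (simp add: weighted_L2_def measurable_restrict_space1)
  have int: "integrable lebesgue (\<lambda>x. (cmod (w x * r x))\<^sup>2)"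
    using r by (simp add: weighted_L2_def w_def)
  have "bounded (cube :: (real ^ 'n) set)" by (simp add: cube_def)
  then obtain M where M: "\<And>x :: real ^ 'n. x \<in> cube \<Longrightarrow> norm x \<le> M" by (auto simp: bounded_iff)
  define v where "v = (1 + M\<^sup>2) powr (- 1 / 4)"
  have "1 + M\<^sup>2 > 0" by (simp add: add_pos_nonneg)
  then have v: "v > 0" by (simp add: v_def)
  have vw: "v \<le> cmod (w x)" if "x \<in> cube" for x
  proof -
    have "(norm x)\<^sup>2 \<le> M\<^sup>2" using M[OF that] by (intro power_mono) auto
    then have "v \<le> (1 + (norm x)\<^sup>2) powr (- 1 / 4)"
      unfolding v_def by (intro powr_mono2') (auto simp: add_pos_nonneg)
    then show ?thesis by (simp add: w_def)
  qed
  have "continuous_on cube (\<lambda>x :: real ^ 'n. w x)"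
    unfolding w_def
    by (intro continuous_intros ballI) (metis add_pos_nonneg less_irrefl zero_le_power2 zero_less_one)
  then have wr_meas: "(\<lambda>x. w x * r x) \<in> borel_measurable cube_measure"
    by (intro borel_measurable_times meas continuous_on_cube_measurable)
  have "set_integrable lebesgue cube (\<lambda>x. (cmod (w x * r x))\<^sup>2)"
    unfolding set_integrable_def by (intro integrable_mult_indicator int) (simp add: cube_def)
  then have "integrable cube_measure (\<lambda>x. (cmod (w x * r x))\<^sup>2)"
    by (subst integrable_restrict_space) (simp_all add: set_integrable_def cube_def)
  then have wr: "(\<lambda>x. w x * r x) \<in> L2" using wr_meas by (simp add: L2_def)
  show "r \<in> L2"
  proof (rule L2_dominated[OF meas wr, where C = "1 / v"])
    have "cmod (r x) \<le> 1 / v * cmod (w x * r x)" if "x \<in> cube" for x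
    proof -
      have "v * cmod (r x) \<le> cmod (w x) * cmod (r x)" using vw[OF that] by (intro mult_right_mono) auto
      then show ?thesis using v by (simp add: norm_mult field_simps)
    qed
    then show "AE x in cube_measure. cmod (r x) \<le> 1 / v * cmod (w x * r x)"
      by (intro AE_I2) simp
  qed
qed

text \<open>
  The two complex frequencies add up to $-2\pi ik$: the real exponents and the $\xi$ terms
  cancel.
\<close>

lemma exp_zeta_product:
  "exp (cdot (zeta2 \<xi> \<eta> k t) (complex_vec x)) * exp (cdot (zeta1 \<xi> \<eta> k t) (complex_vec x)) = cnj (trig k x)"
proof -
  have "cdot (zeta2 \<xi> \<eta> k t) (complex_vec x) + cdot (zeta1 \<xi> \<eta> k t) (complex_vec x)
      = (\<Sum>i\<in>UNIV. (zeta2 \<xi> \<eta> k t $ i + zeta1 \<xi> \<eta> k t $ i) * of_real (x $ i))"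
    by (simp add: cdot_def complex_vec_def distrib_right flip: sum.distrib)
  also have "\<dots> = (\<Sum>i\<in>UNIV. - 2 * of_real pi * \<i> * of_real (real_vec k $ i * x $ i))"
    by (intro sum.cong refl) (simp add: zeta1_def zeta2_def complex_vec_def algebra_simps)
  also have "\<dots> = - 2 * of_real pi * \<i> * of_real (real_vec k \<bullet> x)"
    by (simp add: inner_vec_def sum_distrib_left)
  finally show ?thesis by (simp add: trig_def exp_cnj flip: exp_add)
qed

text \<open>
  The summand $1$ of $1+r$ gives the Fourier coefficient and the summand $r$ gives the remainder
  term. Splitting the integral needs both parts to be integrable, for which $r$ has to be square
  integrable on the cube.
\<close>

lemma U_map_eq:
  assumes threshold: "cgo_threshold \<xi> \<eta> R c" and \<tau>: "\<And>k. \<tau> k \<ge> c" and q: "q \<in> Linf_ball Linf R"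
  shows "U_map \<rho> \<xi> \<eta> \<tau> q l = fourier \<rho> q l + B_map \<rho> \<xi> \<eta> \<tau> q l"
proof -
  let ?k = "\<rho> l" and ?r = "cgo_remainder \<xi> \<eta> q (\<rho> l) (\<tau> (\<rho> l))"
  have "\<exists>r. is_cgo_remainder \<xi> \<eta> q ?k (\<tau> ?k) r"
    using threshold \<tau> q unfolding cgo_threshold_def by blast
  then have "is_cgo_remainder \<xi> \<eta> q ?k (\<tau> ?k) ?r"
    unfolding cgo_remainder_def by (rule someI_ex)
  then have r: "?r \<in> L2" using weighted_L2_subset_L2 by (auto simp: is_cgo_remainder_def)
  have "q \<in> Linf" using q by (simp add: Linf_ball_def)
  then have q_L2: "q \<in> L2" using Linf_subset_L2 by auto
  have qe: "(\<lambda>x. q x * cnj (trig ?k x)) \<in> L2"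
    unfolding cnj_trig
    by (rule L2_dominated[OF borel_measurable_times[OF L2_measurable[OF q_L2] L2_measurable[OF trig_L2]] q_L2, where C = 1])
      (simp add: norm_mult)
  have cnj_r: "(\<lambda>x. cnj (?r x)) \<in> L2"
    by (rule L2_dominated[OF borel_measurable_continuous_on[where f = cnj, OF _ L2_measurable[OF r]] r, where C = 1])
      (simp_all add: continuous_on_cnj)
  have "U_map \<rho> \<xi> \<eta> \<tau> q l
      = (LINT x|cube_measure. q x * cnj (trig ?k x) + (q x * cnj (trig ?k x)) * cnj (cnj (?r x)))"
    unfolding U_map_def cgo_solution_def cgo_form_def exp_zeta_product[of \<xi> \<eta> ?k "\<tau> ?k", symmetric]
    by (simp add: algebra_simps)
  also have "\<dots> = (LINT x|cube_measure. q x * cnj (trig ?k x))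
      + (LINT x|cube_measure. (q x * cnj (trig ?k x)) * cnj (cnj (?r x)))"
    by (intro Bochner_Integration.integral_add L2_inner_integrable q_L2 trig_L2 qe cnj_r)
  also have "\<dots> = fourier \<rho> q l + B_map \<rho> \<xi> \<eta> \<tau> q l"
    by (simp add: fourier_eq_inner L2_inner_def B_map_def trig_def exp_cnj)
  finally show ?thesis .
qed

section \<open>The iteration as a contraction\<close>

lemma ell2_norm_le_imp_sum_le:
  assumes le: "ell2_norm a \<le> ereal C" and L: "finite L" "L \<subseteq> {1..}"
  shows "(\<Sum>l\<in>L. (cmod (a l))\<^sup>2) \<le> C\<^sup>2"
proof -
  have summable: "(\<lambda>l. (cmod (a l))\<^sup>2) summable_on {1..}"
    using le by (auto simp: ell2_norm_def split: if_splits)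
  then have root: "sqrt (\<Sum>\<^sub>\<infinity>l\<in>{1..}. (cmod (a l))\<^sup>2) \<le> C"
    using le by (simp add: ell2_norm_def)
  have "(\<Sum>l\<in>L. (cmod (a l))\<^sup>2) \<le> (\<Sum>\<^sub>\<infinity>l\<in>{1..}. (cmod (a l))\<^sup>2)"
    using L by (intro finite_sum_le_infsum summable) auto
  also have "\<dots> \<le> C\<^sup>2" by (rule sqrt_le_D[OF root])
  finally show ?thesis .
qed

text \<open>
  The operator norm is a supremum over the unit ball, so it is applied to the normalised function,
  on which the orthogonal projection acts trivially up to a null set.
\<close>

lemma fourier_tail_le:
  assumes W: "finite_dim_subspace_Linf W" and g: "g \<in> W"
    and opnorm: "L2_ell2_opnorm (\<lambda>f. seq_proj_compl N (fourier \<rho> (orth_proj W f))) \<le> ereal C"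
    and L: "finite L" "L \<subseteq> {N<..}"
  shows "(\<Sum>l\<in>L. (cmod (fourier \<rho> g l))\<^sup>2) \<le> (C * L2_norm g)\<^sup>2"
proof (cases "L2_norm g = 0")
  case True
  have "fourier \<rho> g l = 0" for l
    using L2_Cauchy_Schwarz[OF finite_dim_subspace_Linf_L2[OF W g] trig_L2, of "\<rho> l"] True
    by (simp add: fourier_eq_inner)
  then show ?thesis by simp
next
  case False
  define u where "u = (\<lambda>x. complex_of_real (1 / L2_norm g) * g x)"
  have u: "u \<in> W" unfolding u_def by (rule finite_dim_subspace_Linf_scale[OF W g])
  have u_L2: "u \<in> L2" by (rule finite_dim_subspace_Linf_L2[OF W u])
  have unit: "L2_norm u = 1"
    using False by (simp only: u_def L2_norm_scale) (simp add: norm_divide)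
  have "ell2_norm (seq_proj_compl N (fourier \<rho> (orth_proj W u)))
      \<le> L2_ell2_opnorm (\<lambda>f. seq_proj_compl N (fourier \<rho> (orth_proj W f)))"
    unfolding L2_ell2_opnorm_def by (rule SUP_upper) (simp add: u_L2 unit)
  then have "ell2_norm (seq_proj_compl N (fourier \<rho> (orth_proj W u))) \<le> ereal C"
    using opnorm by (rule order_trans)
  then have "(\<Sum>l\<in>L. (cmod (seq_proj_compl N (fourier \<rho> (orth_proj W u)) l))\<^sup>2) \<le> C\<^sup>2"
    by (rule ell2_norm_le_imp_sum_le) (use L in auto)
  moreover have "seq_proj_compl N (fourier \<rho> (orth_proj W u)) l = complex_of_real (1 / L2_norm g) * fourier \<rho> g l"
    if "l \<in> L" for l
  proof -
    have "fourier \<rho> (orth_proj W u) l = fourier \<rho> u l"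
      unfolding fourier_eq_inner
      by (intro L2_inner_cong_AE L2_measurable u_L2 trig_L2 orth_proj_AE[OF W u]
          finite_dim_subspace_Linf_L2[OF W])
    also have "\<dots> = complex_of_real (1 / L2_norm g) * fourier \<rho> g l"
      unfolding fourier_eq_inner u_def by (rule L2_inner_scale_left)
    finally show ?thesis using that L by (auto simp: seq_proj_compl_def seq_proj_def)
  qed
  ultimately have "(\<Sum>l\<in>L. (1 / L2_norm g)\<^sup>2 * (cmod (fourier \<rho> g l))\<^sup>2) \<le> C\<^sup>2"
    by (simp add: norm_mult norm_divide power_mult_distrib power_divide)
  then have "(1 / L2_norm g)\<^sup>2 * (\<Sum>l\<in>L. (cmod (fourier \<rho> g l))\<^sup>2) \<le> C\<^sup>2"
    by (simp only: sum_distrib_left)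
  then show ?thesis using False by (simp add: power_mult_distrib power_divide divide_le_eq)
qed

text \<open>
  The properties of the data that the convergence of the iteration rests on.
\<close>

locale reconstruction =
  fixes W :: "(real ^ 'n \<Rightarrow> complex) set" and R :: real and N :: nat
    and \<rho> :: "nat \<Rightarrow> int ^ 'n" and \<xi> \<eta> :: "int ^ 'n \<Rightarrow> real ^ 'n" and \<tau> :: "int ^ 'n \<Rightarrow> real"
    and q :: "real ^ 'n \<Rightarrow> complex"
  assumes W: "finite_dim_subspace_Linf W"
    and enum: "bij_betw \<rho> {1..} UNIV"
    and small: "L2_ell2_opnorm (\<lambda>f. seq_proj_compl N (fourier \<rho> (orth_proj W f))) \<le> ereal (1 / 4)"
    and Lipschitz: "\<And>f g. f \<in> Linf_ball Linf R \<Longrightarrow> g \<in> Linf_ball Linf R \<Longrightarrow>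
      ell2_norm (\<lambda>l. B_map \<rho> \<xi> \<eta> \<tau> g l - B_map \<rho> \<xi> \<eta> \<tau> f l) \<le> ereal (1 / 2 * L2_norm (\<lambda>x. g x - f x))"
    and split: "\<And>l. U_map \<rho> \<xi> \<eta> \<tau> q l = fourier \<rho> q l + B_map \<rho> \<xi> \<eta> \<tau> q l"
    and q: "q \<in> Linf_ball W R"
begin

lemma inj_enum: "inj_on \<rho> {1..}"
  using enum by (rule bij_betw_imp_inj_on)

lemma Linf_ball_L2: "f \<in> Linf_ball W R \<Longrightarrow> f \<in> L2"
  using finite_dim_subspace_Linf_L2[OF W] by (auto simp: Linf_ball_def)

text \<open>
  The function whose nearest point is the next iterate.
\<close>

definition update :: "(real ^ 'n \<Rightarrow> complex) \<Rightarrow> real ^ 'n \<Rightarrow> complex" where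
  "update f x = fourier_inv \<rho> (seq_proj N (U_map \<rho> \<xi> \<eta> \<tau> q)) x
     + fourier_inv \<rho> (seq_proj_compl N (fourier \<rho> f)) x
     - fourier_inv \<rho> (seq_proj N (B_map \<rho> \<xi> \<eta> \<tau> f)) x"

lemma iteration_map_eq:
  "iteration_map \<rho> \<xi> \<eta> \<tau> (Linf_ball W R) N (seq_proj N (U_map \<rho> \<xi> \<eta> \<tau> q)) f
     = nearest_point (Linf_ball W R) (update f)"
  unfolding iteration_map_def update_def ..

lemma update_L2: "f \<in> L2 \<Longrightarrow> update f \<in> L2"
  unfolding update_def
  by (intro L2_add L2_diff fourier_inv_seq_proj inj_enum fourier_inv_seq_proj_compl)

lemma fourier_update:
  assumes f: "f \<in> L2" and l: "l \<ge> 1"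
  shows "fourier \<rho> (update f) l
    = (if l \<le> N then U_map \<rho> \<xi> \<eta> \<tau> q l - B_map \<rho> \<xi> \<eta> \<tau> f l else fourier \<rho> f l)"
proof -
  note [simp] = fourier_inv_seq_proj[OF inj_enum] fourier_inv_seq_proj_compl[OF inj_enum f]
  have "fourier \<rho> (update f) l
      = fourier \<rho> (fourier_inv \<rho> (seq_proj N (U_map \<rho> \<xi> \<eta> \<tau> q))) l
        + fourier \<rho> (fourier_inv \<rho> (seq_proj_compl N (fourier \<rho> f))) l
        - fourier \<rho> (fourier_inv \<rho> (seq_proj N (B_map \<rho> \<xi> \<eta> \<tau> f))) l"
    unfolding update_def fourier_eq_inner[of \<rho> "\<lambda>x. _ x - _ x"] fourier_eq_inner[of _ "fourier_inv _ _"]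
    by (simp add: L2_inner_diff_left L2_inner_add_left L2_add trig_L2)
  then show ?thesis using l by (simp add: seq_proj_def seq_proj_compl_def)
qed

text \<open>
  Low and high frequencies are estimated separately and added as squares by
  \<open>Parseval_bound\<close>; this even gives the square $\frac14+\frac1{16}<\frac9{16}$.
\<close>

lemma update_distance:
  assumes f: "f \<in> Linf_ball W R"
  shows "L2_norm (\<lambda>x. q x - update f x) \<le> 3 / 4 * L2_norm (\<lambda>x. q x - f x)"
proof (rule power2_le_imp_le)
  let ?B = "B_map \<rho> \<xi> \<eta> \<tau>" and ?h = "\<lambda>x. q x - update f x" and ?g = "\<lambda>x. q x - f x"
  define \<delta> where "\<delta> = L2_norm ?g"
  have L2: "f \<in> L2" "q \<in> L2" using f q by (auto intro: Linf_ball_L2)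
  have qf: "q \<in> W" "f \<in> W" using q f by (auto simp: Linf_ball_def)
  have g: "?g \<in> W" by (rule finite_dim_subspace_Linf_diff[OF W qf])
  have h: "?h \<in> L2" by (intro L2_diff L2 update_L2)
  have coeff: "fourier \<rho> ?h l = (if l \<le> N then ?B f l - ?B q l else fourier \<rho> ?g l)" if "l \<ge> 1" for l
    using fourier_update[OF L2(1) that] split[of l]
    by (simp add: fourier_eq_inner L2_inner_diff_left L2 update_L2 trig_L2)
  have "(L2_norm ?h)\<^sup>2 \<le> (1 / 2 * \<delta>)\<^sup>2 + (1 / 4 * \<delta>)\<^sup>2"
  proof (rule Parseval_bound[OF h])
    fix K :: "(int ^ 'n) set" assume "finite K"
    define L where "L = {l \<in> {1..}. \<rho> l \<in> K}"
    have inj_L: "inj_on \<rho> L" by (rule inj_on_subset[OF inj_enum]) (auto simp: L_def)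
    have K: "K = \<rho> ` L"
      using bij_betw_imp_surj_on[OF enum] by (auto simp: L_def image_iff set_eq_iff) (metis atLeast_iff)
    have L: "finite L" using \<open>finite K\<close> inj_L unfolding K by (rule finite_imageD)
    have "(\<Sum>k\<in>K. (cmod (L2_inner ?h (trig k)))\<^sup>2) = (\<Sum>l\<in>L. (cmod (fourier \<rho> ?h l))\<^sup>2)"
      unfolding K fourier_eq_inner by (simp add: sum.reindex[OF inj_L])
    also have "\<dots> = (\<Sum>l\<in>L \<inter> {..N}. (cmod (fourier \<rho> ?h l))\<^sup>2) + (\<Sum>l\<in>L - {..N}. (cmod (fourier \<rho> ?h l))\<^sup>2)"
      by (rule sum.Int_Diff[OF L])
    also have "(\<Sum>l\<in>L \<inter> {..N}. (cmod (fourier \<rho> ?h l))\<^sup>2) = (\<Sum>l\<in>L \<inter> {..N}. (cmod (?B f l - ?B q l))\<^sup>2)"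
      by (intro sum.cong refl) (simp add: coeff L_def)
    also have "\<dots> \<le> (1 / 2 * \<delta>)\<^sup>2"
    proof (rule ell2_norm_le_imp_sum_le)
      have sub: "W \<subseteq> Linf" using W by (simp add: finite_dim_subspace_Linf_def)
      then have "q \<in> Linf_ball Linf R" "f \<in> Linf_ball Linf R" using q f by (auto simp: Linf_ball_def)
      from Lipschitz[OF this]
      show "ell2_norm (\<lambda>l. ?B f l - ?B q l) \<le> ereal (1 / 2 * \<delta>)"
        unfolding \<delta>_def L2_norm_minus_commute[of q f] .
    qed (use L in \<open>auto simp: L_def\<close>)
    also have "(\<Sum>l\<in>L - {..N}. (cmod (fourier \<rho> ?h l))\<^sup>2) = (\<Sum>l\<in>L - {..N}. (cmod (fourier \<rho> ?g l))\<^sup>2)"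
      by (intro sum.cong refl) (simp add: coeff L_def)
    also have "\<dots> \<le> (1 / 4 * \<delta>)\<^sup>2"
      unfolding \<delta>_def by (rule fourier_tail_le[OF W g small]) (use L in \<open>auto simp: L_def\<close>)
    finally show "(\<Sum>k\<in>K. (cmod (L2_inner ?h (trig k)))\<^sup>2) \<le> (1 / 2 * \<delta>)\<^sup>2 + (1 / 4 * \<delta>)\<^sup>2"
      by simp
  qed
  also have "\<dots> \<le> (3 / 4 * \<delta>)\<^sup>2" by (simp add: power_mult_distrib power2_eq_square)
  finally show "(L2_norm ?h)\<^sup>2 \<le> (3 / 4 * L2_norm ?g)\<^sup>2" by (simp only: \<delta>_def)
qed simp

lemma iteration_map_in_ball:
  assumes "f \<in> Linf_ball W R"
  shows "iteration_map \<rho> \<xi> \<eta> \<tau> (Linf_ball W R) N (seq_proj N (U_map \<rho> \<xi> \<eta> \<tau> q)) f \<in> Linf_ball W R"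
  unfolding iteration_map_eq
  by (rule nearest_point_in_Linf_ball[OF W q update_L2[OF Linf_ball_L2[OF assms]]])

lemma iteration_map_distance:
  assumes "f \<in> Linf_ball W R"
  shows "L2_norm (\<lambda>x. q x - iteration_map \<rho> \<xi> \<eta> \<tau> (Linf_ball W R) N (seq_proj N (U_map \<rho> \<xi> \<eta> \<tau> q)) f x)
    \<le> 3 / 4 * L2_norm (\<lambda>x. q x - f x)"
  unfolding iteration_map_eq
  by (rule order_trans[OF nearest_point_closer[OF W q update_L2[OF Linf_ball_L2[OF assms]]] update_distance[OF assms]])

end

theorem theorem6:
  fixes W :: "(real ^ 'n \<Rightarrow> complex) set"
    and q :: "real ^ 'n \<Rightarrow> complex"
    and Q :: "nat \<Rightarrow> real ^ 'n \<Rightarrow> complex"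
    and \<rho> :: "nat \<Rightarrow> int ^ 'n"
    and \<xi> \<eta> :: "int ^ 'n \<Rightarrow> real ^ 'n"
    and p s R c c' :: real
    and N :: nat
    and y :: "nat \<Rightarrow> complex"
  assumes dim: "CARD('n) \<ge> 3"
    and p: "p > real CARD('n)"
    and s: "s > real CARD('n) * p / (2 * (p - real CARD('n)))"
    and R: "R > 0"
    and enum: "bij_betw \<rho> {1..} UNIV"
    and directions: "cgo_directions \<xi> \<eta>"
    and c: "cgo_threshold \<xi> \<eta> R c"
    and c': "cgo_scale \<rho> \<xi> \<eta> s R c c'"
    and W: "finite_dim_subspace_Linf W"
    and q: "q \<in> Linf_ball W R"
    and not_eigenvalue: "\<not> dirichlet_eigenvalue q 0"
    and N: "N \<ge> 1"
    and small: "L2_ell2_opnorm (\<lambda>f. seq_proj_compl N (fourier \<rho> (orth_proj W f))) \<le> ereal (1 / 4)"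
    and y: "y = seq_proj N (U_map \<rho> \<xi> \<eta> (cgo_parameter c' s) q)"
    and init: "Q 0 \<in> Linf_ball W R"
    and step: "\<And>n. n \<ge> 1 \<Longrightarrow>
      Q n = iteration_map \<rho> \<xi> \<eta> (cgo_parameter c' s) (Linf_ball W R) N y (Q (n - 1))"
    and n: "n \<ge> 1"
  shows "L2_norm (\<lambda>x. q x - Q n x) \<le> 4 * (3 / 4) ^ n * L2_norm (\<lambda>x. Q 1 x - Q 0 x)"
proof -
  have "q \<in> Linf_ball Linf R"
    using q W by (auto simp: Linf_ball_def finite_dim_subspace_Linf_def)
  then have split: "U_map \<rho> \<xi> \<eta> (cgo_parameter c' s) q l
      = fourier \<rho> q l + B_map \<rho> \<xi> \<eta> (cgo_parameter c' s) q l" for l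
    using c' by (intro U_map_eq[OF c]) (simp_all add: cgo_scale_def)
  interpret reconstruction W R N \<rho> \<xi> \<eta> "cgo_parameter c' s" q
    using c' by unfold_locales (use W enum small q split in \<open>simp_all add: cgo_scale_def\<close>)
  have Q_Suc: "Q (Suc m) = iteration_map \<rho> \<xi> \<eta> (cgo_parameter c' s) (Linf_ball W R) N
      (seq_proj N (U_map \<rho> \<xi> \<eta> (cgo_parameter c' s) q)) (Q m)" for m
    using step[of "Suc m"] by (simp add: y)
  have Q_in: "Q m \<in> Linf_ball W R" for m
    by (induction m) (simp_all only: init Q_Suc iteration_map_in_ball)
  have contract: "L2_norm (\<lambda>x. q x - Q (Suc m) x) \<le> 3 / 4 * L2_norm (\<lambda>x. q x - Q m x)" for m
    unfolding Q_Suc by (rule iteration_map_distance[OF Q_in])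
  have geometric: "L2_norm (\<lambda>x. q x - Q m x) \<le> (3 / 4) ^ m * L2_norm (\<lambda>x. q x - Q 0 x)" for m
  proof (induction m)
    case (Suc m)
    then show ?case using contract[of m] by simp
  qed simp
  have "L2_norm (\<lambda>x. q x - Q 0 x) \<le> L2_norm (\<lambda>x. q x - Q 1 x) + L2_norm (\<lambda>x. Q 1 x - Q 0 x)"
    using q Q_in by (intro L2_norm_triangle_diff Linf_ball_L2)
  then have "L2_norm (\<lambda>x. q x - Q 0 x) \<le> 4 * L2_norm (\<lambda>x. Q 1 x - Q 0 x)"
    using contract[of 0] by simp
  then have "(3 / 4) ^ n * L2_norm (\<lambda>x. q x - Q 0 x) \<le> (3 / 4) ^ n * (4 * L2_norm (\<lambda>x. Q 1 x - Q 0 x))"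
    by (intro mult_left_mono) simp_all
  with geometric[of n] show ?thesis by linarith
qed

end
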